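(* Let $\Phi$ be a finite set of PDL formulas (without loaded formulas). Then $\Phi$ is consistent (there is no closed PDL-tableau for $\Phi$) if and only if $\Phi$ is satisfiable (true at some state of some Kripke model).
   Context: PDL syntax: $\phi ::= \bot \mid p \mid \lnot\phi \mid \phi\land\phi \mid [\alpha]\phi$, $\alpha ::= a \mid \tau? \mid \alpha\cup\beta \mid \alpha;\beta \mid \alpha^\ast$ ($a$ atomic programs), with standard Kripke semantics. For a list $\bar\delta=\delta_1\cdots\delta_n$ of programs, $\Box(\bar\delta,\phi)=[\delta_1]\cdots[\delta_n]\phi$ ($=\phi$ if $\bar\delta=\varepsilon$ is empty); juxtaposition is concatenation of lists. Unfolding boxes: the shallow tests are $\mathit{Tests}(a)=\emptyset$, $\mathit{Tests}(\tau?)=\{\tau\}$, $\mathit{Tests}(\alpha\cup\beta)=\mathit{Tests}(\alpha;\beta)=\mathit{Tests}(\alpha)\cup\mathit{Tests}(\beta)$, $\mathit{Tests}(\alpha^\ast)=\mathit{Tests}(\alpha)$. For a set $\ell$ of formulas define sets of program lists: $P^\ell(a)=\{a\}$; $P^\ell(\tau?)=\{\varepsilon\}$ if $\tau\in\ell$, $\emptyset$ otherwise; $P^\ell(\beta\cup\gamma)=P^\ell(\beta)\cup P^\ell(\gamma)$; $P^\ell(\beta;\gamma)=\{\bar\beta\gamma\mid\bar\beta\in P^\ell(\beta)\setminus\{\varepsilon\}\}\cup\{\bar\gamma\mid\bar\gamma\in P^\ell(\gamma),\varepsilon\in P^\ell(\beta)\}$; $P^\ell(\beta^\ast)=\{\varepsilon\}\cup\{\bar\beta\beta^\ast\mid\bar\beta\in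 P^\ell(\beta)\setminus\{\varepsilon\}\}$. Let $F^\ell(\alpha)=\{\lnot\tau\mid\tau\in\mathit{Tests}(\alpha),\tau\notin\ell\}$, $X^\ell_{\alpha,\psi}=F^\ell(\alpha)\cup\{\Box(\bar\alpha,\psi)\mid\bar\alpha\in P^\ell(\alpha)\}$ and $\mathsf{unfold}_\Box(\alpha,\psi)=\{X^\ell_{\alpha,\psi}\mid \ell\subseteq\mathit{Tests}(\alpha)\}$. Unfolding diamonds: $H_a=\{(\emptyset,a)\}$, $H_{\tau?}=\{(\{\tau\},\varepsilon)\}$, $H_{\alpha\cup\beta}=H_\alpha\cup H_\beta$, $H_{\alpha;\beta}=\{(X,\bar\delta\beta)\mid(X,\bar\delta)\in H_\alpha,\bar\delta\neq\varepsilon\}\cup\{(X\cup Y,\bar\delta)\mid(X,\varepsilon)\in H_\alpha,(Y,\bar\delta)\in H_\beta\}$, $H_{\alpha^\ast}=\{(\emptyset,\varepsilon)\}\cup\{(X,\bar\delta\alpha^\ast)\mid(X,\bar\delta)\in H_\alpha,\bar\delta\neq\varepsilon\}$; $\mathsf{unfold}_\Diamond(\alpha,\psi)=\{X\cup\{\lnot\Box(\bar\delta,\psi)\}\mid(X,\bar\delta)\in H_\alpha\}$. Loading: for each program $\alpha$ there is a marked copy $\underline{\alpha}$ (semantically identical to $\alpha$). A loaded formula has the form $\lnot[\underline{\alpha_1}]\cdots[\underline{\alpha_{n}}]\phi$ with $n\ge1$ and $\phi$ an unmarked PDL formula; a "possibly loaded box" $\xi$ is either a PDL formula or of the form $[\underline{\alpha_1}]\cdots[\underline{\alpha_k}]\phi$,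 $k\ge1$. $\underline{\Box}(\bar\delta,\xi)=[\underline{\delta_1}]\cdots[\underline{\delta_n}]\xi$ and $\underline{\mathsf{unfold}}_\Diamond(\alpha,\xi)=\{X\cup\{\lnot\underline{\Box}(\bar\delta,\xi)\}\mid(X,\bar\delta)\in H_\alpha\}$. A sequent is a finite set of (possibly loaded) formulas; it is loaded if it contains a loaded formula, free otherwise. It is basic if all its formulas have the form $\bot,\lnot\bot,p,\lnot p,[a]\phi$ or $\lnot[a]\phi$ with $a$ atomic. $\Delta_a=\{\phi\mid[a]\phi\in\Delta\}$. Rules (written parent / children; the principal formula is never in the context $\Delta$): $(\lnot)$ $\Delta,\lnot\lnot\phi\,/\,\Delta,\phi$; $(\land)$ $\Delta,\phi\land\psi\,/\,\Delta,\phi,\psi$; $(\lnot\land)$ $\Delta,\lnot(\phi\land\psi)\,/\,\Delta,\lnot\phi\mid\Delta,\lnot\psi$; $(\Box)$ $\Delta,[\alpha]\phi\,/\,\{\Delta\cup\Gamma\mid\Gamma\in\mathsf{unfold}_\Box(\alpha,\phi)\}$ for $\alpha$ non-atomic; $(\Diamond)$ $\Delta,\lnot[\alpha]\phi\,/\,\{\Delta\cup\Gamma\mid\Gamma\in\mathsf{unfold}_\Diamond(\alpha,\phi)\}$ for $\alpha$ non-atomic; $(\underline\Diamond)$ $\Delta,\lnot[\underline\alpha]\xi\,/\,\{\Delta\cup\Gamma\mid\Gamma\in\underline{\mathsf{unfold}}_\Diamond(\alpha,\xi)\}$ for $\alpha$ non-atomic; $(L+)$ $\Delta,\lnot[a][\alpha_1]\cdots[\alpha_n]\phi\,/\,\Delta,\lnot[\underline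 a][\underline{\alpha_1}]\cdots[\underline{\alpha_n}]\phi$ where $\Delta$ is free and basic and $n\ge0$ is maximal ($\phi$ not a box formula); $(L-)$ $\Delta,\lnot[\underline{\alpha_1}]\cdots[\underline{\alpha_n}]\phi\,/\,\Delta,\lnot[\alpha_1]\cdots[\alpha_n]\phi$ where $\Delta$ is basic and $n\ge1$; and the modal rule $(M)$ $\Delta,\lnot[\underline a]\xi\,/\,\Delta_a,\lnot\xi$ where $\Delta$ is basic. All rules except $(M)$ are local. Moreover $(L-)$ may not be applied to a node that was produced by $(L+)$. A tableau for $\Gamma$ is a finite-or-infinite rooted tree whose nodes are labelled by sequents, root labelled $\Gamma$, such that each interior node with its children is an instance of a rule. A repeat is a node $t$ whose label equals that of a proper ancestor; the nearest such ancestor is its companion. A repeat is a loaded-path repeat if all nodes on the path from its companion to it (inclusive) are loaded, and a free repeat if it is free. A PDL-tableau is a tableau in which every loaded-path repeat and every free repeat is a leaf. A node is closed if its label contains $\bot$ or both $\phi$ and $\lnot\phi$ for some $\phi$; a PDL-tableau is closed if every leaf is closed or a loaded-path repeat. *)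

theory Defs
  imports Main "HOL-Library.Sublist"
begin

section \<open>Syntax and Kripke semantics of PDL\<close>

datatype ('p, 'a) fm =
    Bot
  | Var 'p
  | Neg "('p, 'a) fm"
  | Con "('p, 'a) fm" "('p, 'a) fm"
  | Box "('p, 'a) prog" "('p, 'a) fm"
and ('p, 'a) prog =
    Atom 'a
  | Test "('p, 'a) fm"
  | Choice "('p, 'a) prog" "('p, 'a) prog"
  | Seq "('p, 'a) prog" "('p, 'a) prog"
  | Star "('p, 'a) prog"

record ('w, 'p, 'a) kripke =
  states :: "'w set"
  acc :: "'a \<Rightarrow> ('w \<times> 'w) set"
  val :: "'p \<Rightarrow> 'w set"

definition kripke_model :: "('w, 'p, 'a) kripke \<Rightarrow> bool" where
  "kripke_model M \<longleftrightarrow>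
     states M \<noteq> {} \<and>
     (\<forall>a. acc M a \<subseteq> states M \<times> states M) \<and>
     (\<forall>p. val M p \<subseteq> states M)"

text \<open>The restriction in the clause for \<open>Star\<close> is needed because \<open>rtrancl\<close> is reflexive on
  the whole type rather than on the set of states.\<close>

primrec sat :: "('w, 'p, 'a) kripke \<Rightarrow> ('p, 'a) fm \<Rightarrow> 'w \<Rightarrow> bool"
  and prel :: "('w, 'p, 'a) kripke \<Rightarrow> ('p, 'a) prog \<Rightarrow> ('w \<times> 'w) set" where
  "sat M Bot w \<longleftrightarrow> False"
| "sat M (Var p) w \<longleftrightarrow> w \<in> val M p"
| "sat M (Neg \<phi>) w \<longleftrightarrow> \<not> sat M \<phi> w"
| "sat M (Con \<phi> \<psi>) w \<longleftrightarrow> sat M \<phi> w \<and> sat M \<psi> w"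
| "sat M (Box \<alpha> \<phi>) w \<longleftrightarrow> (\<forall>v. (w, v) \<in> prel M \<alpha> \<longrightarrow> sat M \<phi> v)"
| "prel M (Atom a) = acc M a"
| "prel M (Test \<tau>) = {(w, w) | w. w \<in> states M \<and> sat M \<tau> w}"
| "prel M (Choice \<alpha> \<beta>) = prel M \<alpha> \<union> prel M \<beta>"
| "prel M (Seq \<alpha> \<beta>) = prel M \<alpha> O prel M \<beta>"
| "prel M (Star \<alpha>) = (prel M \<alpha>)\<^sup>* \<inter> states M \<times> states M"

text \<open>HOL cannot quantify over types inside a formula, so satisfiability is relative to the type
  from which the states of the model are drawn.\<close>

definition satisfiable :: "'w itself \<Rightarrow> ('p, 'a) fm set \<Rightarrow> bool" where
  "satisfiable (_ :: 'w itself) \<Phi> \<longleftrightarrow>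
     (\<exists>(M :: ('w, 'p, 'a) kripke) w.
        kripke_model M \<and> w \<in> states M \<and> (\<forall>\<phi>\<in>\<Phi>. sat M \<phi> w))"

section \<open>Unfolding\<close>

abbreviation boxes :: "('p, 'a) prog list \<Rightarrow> ('p, 'a) fm \<Rightarrow> ('p, 'a) fm" where
  "boxes \<delta> \<phi> \<equiv> foldr Box \<delta> \<phi>"

primrec tests :: "('p, 'a) prog \<Rightarrow> ('p, 'a) fm set" where
  "tests (Atom a) = {}"
| "tests (Test \<tau>) = {\<tau>}"
| "tests (Choice \<alpha> \<beta>) = tests \<alpha> \<union> tests \<beta>"
| "tests (Seq \<alpha> \<beta>) = tests \<alpha> \<union> tests \<beta>"
| "tests (Star \<alpha>) = tests \<alpha>"

primrec P :: "('p, 'a) fm set \<Rightarrow> ('p, 'a) prog \<Rightarrow> ('p, 'a) prog list set" where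
  "P l (Atom a) = {[Atom a]}"
| "P l (Test \<tau>) = (if \<tau> \<in> l then {[]} else {})"
| "P l (Choice \<beta> \<gamma>) = P l \<beta> \<union> P l \<gamma>"
| "P l (Seq \<beta> \<gamma>) =
     {\<delta> @ [\<gamma>] | \<delta>. \<delta> \<in> P l \<beta> - {[]}} \<union> {\<delta>. \<delta> \<in> P l \<gamma> \<and> [] \<in> P l \<beta>}"
| "P l (Star \<beta>) = {[]} \<union> {\<delta> @ [Star \<beta>] | \<delta>. \<delta> \<in> P l \<beta> - {[]}}"

definition F :: "('p, 'a) fm set \<Rightarrow> ('p, 'a) prog \<Rightarrow> ('p, 'a) fm set" where
  "F l \<alpha> = {Neg \<tau> | \<tau>. \<tau> \<in> tests \<alpha> \<and> \<tau> \<notin> l}"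

definition X :: "('p, 'a) fm set \<Rightarrow> ('p, 'a) prog \<Rightarrow> ('p, 'a) fm \<Rightarrow> ('p, 'a) fm set" where
  "X l \<alpha> \<psi> = F l \<alpha> \<union> {boxes \<delta> \<psi> | \<delta>. \<delta> \<in> P l \<alpha>}"

definition unfold_box :: "('p, 'a) prog \<Rightarrow> ('p, 'a) fm \<Rightarrow> ('p, 'a) fm set set" where
  "unfold_box \<alpha> \<psi> = {X l \<alpha> \<psi> | l. l \<subseteq> tests \<alpha>}"

primrec H :: "('p, 'a) prog \<Rightarrow> (('p, 'a) fm set \<times> ('p, 'a) prog list) set" where
  "H (Atom a) = {({}, [Atom a])}"
| "H (Test \<tau>) = {({\<tau>}, [])}"
| "H (Choice \<alpha> \<beta>) = H \<alpha> \<union> H \<beta>"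
| "H (Seq \<alpha> \<beta>) =
     {(Y, \<delta> @ [\<beta>]) | Y \<delta>. (Y, \<delta>) \<in> H \<alpha> \<and> \<delta> \<noteq> []} \<union>
     {(Y \<union> Z, \<delta>) | Y Z \<delta>. (Y, []) \<in> H \<alpha> \<and> (Z, \<delta>) \<in> H \<beta>}"
| "H (Star \<alpha>) = {({}, [])} \<union> {(Y, \<delta> @ [Star \<alpha>]) | Y \<delta>. (Y, \<delta>) \<in> H \<alpha> \<and> \<delta> \<noteq> []}"

definition unfold_dia :: "('p, 'a) prog \<Rightarrow> ('p, 'a) fm \<Rightarrow> ('p, 'a) fm set set" where
  "unfold_dia \<alpha> \<psi> = {Y \<union> {Neg (boxes \<delta> \<psi>)} | Y \<delta>. (Y, \<delta>) \<in> H \<alpha>}"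

section \<open>Loaded formulas and sequents\<close>

text \<open>A possibly loaded box is a block of marked boxes (possibly none) in front of a PDL formula.
  A sequent consists of PDL formulas \<open>Free \<phi>\<close> and loaded formulas; \<open>Loaded \<alpha> \<xi>\<close> is the
  negation of the marked box of \<open>\<alpha>\<close> in front of \<open>\<xi>\<close>.\<close>

datatype ('p, 'a) lbox =
    Plain "('p, 'a) fm"
  | LBox "('p, 'a) prog" "('p, 'a) lbox"

datatype ('p, 'a) sfm =
    Free "('p, 'a) fm"
  | Loaded "('p, 'a) prog" "('p, 'a) lbox"

type_synonym ('p, 'a) sequent = "('p, 'a) sfm set"

primrec lneg :: "('p, 'a) lbox \<Rightarrow> ('p, 'a) sfm" where
  "lneg (Plain \<phi>) = Free (Neg \<phi>)"
| "lneg (LBox \<alpha> \<xi>) = Loaded \<alpha> \<xi>"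

abbreviation lboxes :: "('p, 'a) prog list \<Rightarrow> ('p, 'a) lbox \<Rightarrow> ('p, 'a) lbox" where
  "lboxes \<delta> \<xi> \<equiv> foldr LBox \<delta> \<xi>"

definition unfold_ldia :: "('p, 'a) prog \<Rightarrow> ('p, 'a) lbox \<Rightarrow> ('p, 'a) sequent set" where
  "unfold_ldia \<alpha> \<xi> = {Free ` Y \<union> {lneg (lboxes \<delta> \<xi>)} | Y \<delta>. (Y, \<delta>) \<in> H \<alpha>}"

definition loaded :: "('p, 'a) sequent \<Rightarrow> bool" where
  "loaded \<Delta> \<longleftrightarrow> (\<exists>\<alpha> \<xi>. Loaded \<alpha> \<xi> \<in> \<Delta>)"

definition basic :: "('p, 'a) sequent \<Rightarrow> bool" where
  "basic \<Delta> \<longleftrightarrow>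
     (\<forall>f\<in>\<Delta>. f = Free Bot \<or> f = Free (Neg Bot) \<or>
        (\<exists>p. f = Free (Var p)) \<or> (\<exists>p. f = Free (Neg (Var p))) \<or>
        (\<exists>a \<phi>. f = Free (Box (Atom a) \<phi>)) \<or> (\<exists>a \<phi>. f = Free (Neg (Box (Atom a) \<phi>))))"

definition proj :: "'a \<Rightarrow> ('p, 'a) sequent \<Rightarrow> ('p, 'a) sequent" where
  "proj a \<Delta> = {Free \<phi> | \<phi>. Free (Box (Atom a) \<phi>) \<in> \<Delta>}"

definition atomic :: "('p, 'a) prog \<Rightarrow> bool" where
  "atomic \<alpha> \<longleftrightarrow> (\<exists>a. \<alpha> = Atom a)"

section \<open>Rules and tableaux\<close>

datatype rule_name = RNeg | RCon | RNegCon | RBox | RDia | RLDia | RLPlus | RLMinus | RM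

inductive rule_inst :: "rule_name \<Rightarrow> ('p, 'a) sequent \<Rightarrow> ('p, 'a) sequent set \<Rightarrow> bool" where
  neg: "Free (Neg (Neg \<phi>)) \<notin> \<Delta> \<Longrightarrow>
     rule_inst RNeg (\<Delta> \<union> {Free (Neg (Neg \<phi>))}) {\<Delta> \<union> {Free \<phi>}}"
| con: "Free (Con \<phi> \<psi>) \<notin> \<Delta> \<Longrightarrow>
     rule_inst RCon (\<Delta> \<union> {Free (Con \<phi> \<psi>)}) {\<Delta> \<union> {Free \<phi>, Free \<psi>}}"
| neg_con: "Free (Neg (Con \<phi> \<psi>)) \<notin> \<Delta> \<Longrightarrow>
     rule_inst RNegCon (\<Delta> \<union> {Free (Neg (Con \<phi> \<psi>))})
       {\<Delta> \<union> {Free (Neg \<phi>)}, \<Delta> \<union> {Free (Neg \<psi>)}}"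
| box: "Free (Box \<alpha> \<phi>) \<notin> \<Delta> \<Longrightarrow> \<not> atomic \<alpha> \<Longrightarrow>
     rule_inst RBox (\<Delta> \<union> {Free (Box \<alpha> \<phi>)}) {\<Delta> \<union> Free ` \<Gamma> | \<Gamma>. \<Gamma> \<in> unfold_box \<alpha> \<phi>}"
| dia: "Free (Neg (Box \<alpha> \<phi>)) \<notin> \<Delta> \<Longrightarrow> \<not> atomic \<alpha> \<Longrightarrow>
     rule_inst RDia (\<Delta> \<union> {Free (Neg (Box \<alpha> \<phi>))}) {\<Delta> \<union> Free ` \<Gamma> | \<Gamma>. \<Gamma> \<in> unfold_dia \<alpha> \<phi>}"
| ldia: "Loaded \<alpha> \<xi> \<notin> \<Delta> \<Longrightarrow> \<not> atomic \<alpha> \<Longrightarrow>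
     rule_inst RLDia (\<Delta> \<union> {Loaded \<alpha> \<xi>}) {\<Delta> \<union> \<Gamma> | \<Gamma>. \<Gamma> \<in> unfold_ldia \<alpha> \<xi>}"
| lplus: "Free (Neg (Box (Atom a) (boxes \<delta> \<phi>))) \<notin> \<Delta> \<Longrightarrow> \<not> loaded \<Delta> \<Longrightarrow> basic \<Delta> \<Longrightarrow>
     \<nexists>\<beta> \<psi>. \<phi> = Box \<beta> \<psi> \<Longrightarrow>
     rule_inst RLPlus (\<Delta> \<union> {Free (Neg (Box (Atom a) (boxes \<delta> \<phi>)))})
       {\<Delta> \<union> {Loaded (Atom a) (lboxes \<delta> (Plain \<phi>))}}"
| lminus: "\<delta> \<noteq> [] \<Longrightarrow> lneg (lboxes \<delta> (Plain \<phi>)) \<notin> \<Delta> \<Longrightarrow> basic \<Delta> \<Longrightarrow>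
     rule_inst RLMinus (\<Delta> \<union> {lneg (lboxes \<delta> (Plain \<phi>))}) {\<Delta> \<union> {Free (Neg (boxes \<delta> \<phi>))}}"
| modal: "Loaded (Atom a) \<xi> \<notin> \<Delta> \<Longrightarrow> basic \<Delta> \<Longrightarrow>
     rule_inst RM (\<Delta> \<union> {Loaded (Atom a) \<xi>}) {proj a \<Delta> \<union> {lneg \<xi>}}"

text \<open>The nodes of a tableau form a prefix-closed set of positions, the root being \<open>[]\<close>; hence
  the ancestors of a node are its prefixes. The component \<open>applied\<close> gives the name of the rule
  applied at an interior node and is irrelevant at leaves.\<close>

record ('p, 'a) tableau =
  nodes :: "nat list set"
  lab :: "nat list \<Rightarrow> ('p, 'a) sequent"
  applied :: "nat list \<Rightarrow> rule_name"

definition children :: "('p, 'a) tableau \<Rightarrow> nat list \<Rightarrow> nat list set" where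
  "children T s = {s @ [i] | i. s @ [i] \<in> nodes T}"

definition leaf :: "('p, 'a) tableau \<Rightarrow> nat list \<Rightarrow> bool" where
  "leaf T s \<longleftrightarrow> s \<in> nodes T \<and> children T s = {}"

definition interior :: "('p, 'a) tableau \<Rightarrow> nat list \<Rightarrow> bool" where
  "interior T s \<longleftrightarrow> s \<in> nodes T \<and> children T s \<noteq> {}"

definition tableau_for :: "('p, 'a) sequent \<Rightarrow> ('p, 'a) tableau \<Rightarrow> bool" where
  "tableau_for \<Gamma> T \<longleftrightarrow>
     [] \<in> nodes T \<and> (\<forall>s i. s @ [i] \<in> nodes T \<longrightarrow> s \<in> nodes T) \<and>
     (\<forall>s\<in>nodes T. finite (children T s) \<and> finite (lab T s)) \<and>
     lab T [] = \<Gamma> \<and>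
     (\<forall>s. interior T s \<longrightarrow> rule_inst (applied T s) (lab T s) (lab T ` children T s)) \<and>
     (\<forall>s t. interior T s \<and> t \<in> children T s \<and> interior T t \<and> applied T s = RLPlus
        \<longrightarrow> applied T t \<noteq> RLMinus)"

definition repeat :: "('p, 'a) tableau \<Rightarrow> nat list \<Rightarrow> bool" where
  "repeat T s \<longleftrightarrow> s \<in> nodes T \<and> (\<exists>c. strict_prefix c s \<and> lab T c = lab T s)"

definition companion :: "('p, 'a) tableau \<Rightarrow> nat list \<Rightarrow> nat list \<Rightarrow> bool" where
  "companion T s c \<longleftrightarrow>
     s \<in> nodes T \<and> strict_prefix c s \<and> lab T c = lab T s \<and>
     (\<forall>d. strict_prefix c d \<and> strict_prefix d s \<longrightarrow> lab T d \<noteq> lab T s)"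

definition loaded_path_repeat :: "('p, 'a) tableau \<Rightarrow> nat list \<Rightarrow> bool" where
  "loaded_path_repeat T s \<longleftrightarrow>
     (\<exists>c. companion T s c \<and> (\<forall>d. prefix c d \<and> prefix d s \<longrightarrow> loaded (lab T d)))"

definition free_repeat :: "('p, 'a) tableau \<Rightarrow> nat list \<Rightarrow> bool" where
  "free_repeat T s \<longleftrightarrow> repeat T s \<and> \<not> loaded (lab T s)"

definition pdl_tableau_for :: "('p, 'a) sequent \<Rightarrow> ('p, 'a) tableau \<Rightarrow> bool" where
  "pdl_tableau_for \<Gamma> T \<longleftrightarrow>
     tableau_for \<Gamma> T \<and> (\<forall>s. loaded_path_repeat T s \<or> free_repeat T s \<longrightarrow> leaf T s)"

definition closed_sequent :: "('p, 'a) sequent \<Rightarrow> bool" where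
  "closed_sequent \<Delta> \<longleftrightarrow> Free Bot \<in> \<Delta> \<or> (\<exists>\<phi>. Free \<phi> \<in> \<Delta> \<and> Free (Neg \<phi>) \<in> \<Delta>)"

definition closed_tableau :: "('p, 'a) tableau \<Rightarrow> bool" where
  "closed_tableau T \<longleftrightarrow>
     (\<forall>s. leaf T s \<longrightarrow> closed_sequent (lab T s) \<or> loaded_path_repeat T s)"

definition consistent :: "('p, 'a) fm set \<Rightarrow> bool" where
  "consistent \<Phi> \<longleftrightarrow> \<not> (\<exists>T. pdl_tableau_for (Free ` \<Phi>) T \<and> closed_tableau T)"

end

theory Submission
  imports Defs "HOL-Library.Multiset" "HOL-Library.While_Combinator"
begin

text \<open>Soundness: consider a model whose atomic steps increase a rank. A satisfied loaded formula
  has a falsifying path, whose end is kept while one descends through satisfied children. The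
  difference between the rank of the end and that of the current state then never grows, and it
  shrinks at every modal step. The remaining rules on a loaded path terminate, so jumping from
  loaded-path repeats to their companions cannot go on forever; the descent has to leave the loaded
  part for a satisfied free node further down. As branches are finite, this is absurd. An arbitrary
  model is turned into a ranked one by pairing states with a step counter.

  Completeness: seen as a game, the prover wins an infinite play that stays loaded (it contains a
  loaded-path repeat), and any other play only by closing it. The free sequents won by the prover
  thus form a least fixed point over a greatest fixed point of loaded sequents. A positional winning
  strategy along which the stages of free sequents decrease unravels to a closed tableau. In the
  complement, the basic free sequents are the states of a model in which \<open>a\<close> relates \<open>s\<close> to \<open>t\<close>
  iff \<open>t\<close> entails every \<open>\<phi>\<close> with \<open>[a]\<phi>\<close> in \<open>s\<close>; here a basic sequent entails what the
  rules that expand a free formula, read from children to parent, yield from it. The loaded sequents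
  of the complement form a least fixed point, which is why diamonds over iterations are realised
  after finitely many steps.\<close>

section \<open>Programs as relations\<close>

lemma prog_induct [case_names Atom Test Choice Seq Star]:
  assumes "\<And>a. Q (Atom a)" "\<And>\<tau>. Q (Test \<tau>)"
    and "\<And>\<alpha> \<beta>. Q \<alpha> \<Longrightarrow> Q \<beta> \<Longrightarrow> Q (Choice \<alpha> \<beta>)"
    and "\<And>\<alpha> \<beta>. Q \<alpha> \<Longrightarrow> Q \<beta> \<Longrightarrow> Q (Seq \<alpha> \<beta>)"
    and "\<And>\<alpha>. Q \<alpha> \<Longrightarrow> Q (Star \<alpha>)"
  shows "Q \<alpha>"
  by (rule prog.induct[of "\<lambda>_. True" Q]) (simp_all add: assms)

text \<open>The completeness proof uses two test predicates besides truth: entailment of the test and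
  failure to entail its negation.\<close>

primrec prog_rel :: "'w set \<Rightarrow> ('a \<Rightarrow> ('w \<times> 'w) set) \<Rightarrow> (('p, 'a) fm \<Rightarrow> 'w \<Rightarrow> bool)
    \<Rightarrow> ('p, 'a) prog \<Rightarrow> ('w \<times> 'w) set" where
  "prog_rel S R T (Atom a) = R a"
| "prog_rel S R T (Test \<tau>) = {(w, w) | w. w \<in> S \<and> T \<tau> w}"
| "prog_rel S R T (Choice \<alpha> \<beta>) = prog_rel S R T \<alpha> \<union> prog_rel S R T \<beta>"
| "prog_rel S R T (Seq \<alpha> \<beta>) = prog_rel S R T \<alpha> O prog_rel S R T \<beta>"
| "prog_rel S R T (Star \<alpha>) = (prog_rel S R T \<alpha>)\<^sup>* \<inter> S \<times> S"

primrec progs_rel :: "'w set \<Rightarrow> ('a \<Rightarrow> ('w \<times> 'w) set) \<Rightarrow> (('p, 'a) fm \<Rightarrow> 'w \<Rightarrow> bool)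
    \<Rightarrow> ('p, 'a) prog list \<Rightarrow> ('w \<times> 'w) set" where
  "progs_rel S R T [] = Id"
| "progs_rel S R T (\<alpha> # \<delta>) = prog_rel S R T \<alpha> O progs_rel S R T \<delta>"

lemma progs_rel_append: "progs_rel S R T (\<delta> @ \<eta>) = progs_rel S R T \<delta> O progs_rel S R T \<eta>"
  by (induction \<delta>) auto

lemma prog_rel_subset_Times:
  assumes "\<forall>a. R a \<subseteq> S \<times> S"
  shows "prog_rel S R T \<alpha> \<subseteq> S \<times> S"
proof (induction \<alpha> rule: prog_induct)
  case (Atom a)
  show ?case using assms by simp
qed auto

lemma prog_rel_subset_rtrancl: "prog_rel S R T \<alpha> \<subseteq> (\<Union>a. R a)\<^sup>*"
proof (induction \<alpha> rule: prog_induct)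
  case (Seq \<alpha> \<beta>)
  then show ?case by (auto intro: rtrancl_trans)
next
  case (Star \<alpha>)
  then have "(prog_rel S R T \<alpha>)\<^sup>* \<subseteq> (\<Union>a. R a)\<^sup>*" by (rule rtrancl_subset_rtrancl)
  then show ?case by auto
qed auto

lemma progs_rel_subset_rtrancl: "progs_rel S R T \<delta> \<subseteq> (\<Union>a. R a)\<^sup>*"
proof (induction \<delta>)
  case (Cons \<alpha> \<delta>)
  then show ?case using prog_rel_subset_rtrancl[of S R T \<alpha>] by (auto intro: rtrancl_trans)
qed auto

lemma progs_rel_closed:
  assumes "\<forall>a. R a \<subseteq> S \<times> S" "(w, v) \<in> progs_rel S R T \<delta>" "w \<in> S"
  shows "v \<in> S"
proof -
  have "(w, v) \<in> (\<Union>a. R a)\<^sup>*" using assms(2) progs_rel_subset_rtrancl by blast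
  then show ?thesis by (induction rule: rtrancl_induct) (use assms(1,3) in blast)+
qed

lemma prog_rel_mono:
  assumes "\<And>\<tau> w. \<tau> \<in> tests \<alpha> \<Longrightarrow> w \<in> S \<Longrightarrow> T \<tau> w \<Longrightarrow> T' \<tau> w"
  shows "prog_rel S R T \<alpha> \<subseteq> prog_rel S R T' \<alpha>"
  using assms
proof (induction \<alpha> rule: prog_induct)
  case (Choice \<alpha> \<beta>)
  then show ?case by (simp add: le_supI1 le_supI2)
next
  case (Seq \<alpha> \<beta>)
  then show ?case by (simp add: relcomp_mono)
next
  case (Star \<alpha>)
  then have "(prog_rel S R T \<alpha>)\<^sup>* \<subseteq> (prog_rel S R T' \<alpha>)\<^sup>*" by (intro rtrancl_mono) simp
  then show ?case by auto
qed auto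

lemma progs_rel_mono:
  assumes "\<And>\<alpha> \<tau> w. \<alpha> \<in> set \<delta> \<Longrightarrow> \<tau> \<in> tests \<alpha> \<Longrightarrow> w \<in> S \<Longrightarrow> T \<tau> w \<Longrightarrow> T' \<tau> w"
  shows "progs_rel S R T \<delta> \<subseteq> progs_rel S R T' \<delta>"
  using assms
proof (induction \<delta>)
  case (Cons \<alpha> \<delta>)
  have "prog_rel S R T \<alpha> \<subseteq> prog_rel S R T' \<alpha>" by (rule prog_rel_mono) (use Cons.prems in auto)
  moreover have "progs_rel S R T \<delta> \<subseteq> progs_rel S R T' \<delta>" by (rule Cons.IH) (use Cons.prems in auto)
  ultimately show ?case by (simp add: relcomp_mono)
qed auto

lemma prel_eq_prog_rel: "prel M \<alpha> = prog_rel (states M) (acc M) (sat M) \<alpha>"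
  by (induction \<alpha> rule: prog_induct) auto

abbreviation prels :: "('w, 'p, 'a) kripke \<Rightarrow> ('p, 'a) prog list \<Rightarrow> ('w \<times> 'w) set" where
  "prels M \<equiv> progs_rel (states M) (acc M) (sat M)"

lemma sat_boxes: "sat M (boxes \<delta> \<phi>) w \<longleftrightarrow> (\<forall>v. (w, v) \<in> prels M \<delta> \<longrightarrow> sat M \<phi> v)"
  by (induction \<delta> arbitrary: w) (auto simp: prel_eq_prog_rel)

lemma kripke_model_acc: "kripke_model M \<Longrightarrow> \<forall>a. acc M a \<subseteq> states M \<times> states M"
  by (simp add: kripke_model_def)

section \<open>Unfolding programs\<close>

lemma H_head: "(Y, \<delta>) \<in> H \<alpha> \<Longrightarrow> \<delta> = [] \<or> (\<exists>a \<eta>. \<delta> = Atom a # \<eta>)"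
  by (induction \<alpha> arbitrary: Y \<delta> rule: prog_induct) fastforce+

lemma H_tests: "(Y, \<delta>) \<in> H \<alpha> \<Longrightarrow> Y \<subseteq> tests \<alpha>"
  by (induction \<alpha> arbitrary: Y \<delta> rule: prog_induct) fastforce+

lemma H_nonempty: "H \<alpha> \<noteq> {}"
proof (induction \<alpha> rule: prog_induct)
  case (Seq \<alpha> \<beta>)
  then obtain Y \<delta> Z \<eta> where "(Y, \<delta>) \<in> H \<alpha>" "(Z, \<eta>) \<in> H \<beta>" by fastforce
  then show ?case by (cases "\<delta> = []") auto
qed auto

lemma finite_H: "finite (H \<alpha>)"
proof (induction \<alpha> rule: prog_induct)
  case (Seq \<alpha> \<beta>)
  have "H (Seq \<alpha> \<beta>) \<subseteq> (\<lambda>(Y, \<delta>). (Y, \<delta> @ [\<beta>])) ` H \<alpha> \<union>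
      (\<lambda>((Y, \<eta>), (Z, \<delta>)). (Y \<union> Z, \<delta>)) ` (H \<alpha> \<times> H \<beta>)"
    by (auto intro: rev_image_eqI)
  then show ?case using Seq by (meson finite_SigmaI finite_UnI finite_imageI finite_subset)
next
  case (Star \<alpha>)
  have "H (Star \<alpha>) \<subseteq> insert ({}, []) ((\<lambda>(Y, \<delta>). (Y, \<delta> @ [Star \<alpha>])) ` H \<alpha>)"
    by (auto intro: rev_image_eqI)
  then show ?case using Star by (meson finite_insert finite_imageI finite_subset)
qed auto

lemma finite_tests: "finite (tests \<alpha>)"
  by (induction \<alpha> rule: prog_induct) auto

lemma size_tests: "\<tau> \<in> tests \<alpha> \<Longrightarrow> size \<tau> < size \<alpha>"
  by (induction \<alpha> rule: prog_induct) auto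

lemma P_imp_H: "\<delta> \<in> P l \<alpha> \<Longrightarrow> \<exists>Y\<subseteq>l. (Y, \<delta>) \<in> H \<alpha>"
proof (induction \<alpha> arbitrary: \<delta> rule: prog_induct)
  case (Seq \<alpha> \<beta>)
  from Seq.prems consider (head) \<eta> where "\<delta> = \<eta> @ [\<beta>]" "\<eta> \<in> P l \<alpha>" "\<eta> \<noteq> []"
    | (tail) "\<delta> \<in> P l \<beta>" "[] \<in> P l \<alpha>" by auto
  then show ?case
  proof cases
    case head
    then show ?thesis using Seq.IH(1)[of \<eta>] by auto
  next
    case tail
    then obtain Y Z where "Y \<subseteq> l" "Z \<subseteq> l" "(Y, []) \<in> H \<alpha>" "(Z, \<delta>) \<in> H \<beta>"
      using Seq.IH(1)[of "[]"] Seq.IH(2)[of \<delta>] by auto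
    then have "Y \<union> Z \<subseteq> l" "(Y \<union> Z, \<delta>) \<in> H (Seq \<alpha> \<beta>)" by auto
    then show ?thesis by blast
  qed
next
  case (Choice \<alpha> \<beta>)
  then show ?case by (metis H.simps(3) P.simps(3) Un_iff)
next
  case (Star \<alpha>)
  from Star.prems consider (stop) "\<delta> = []"
    | (continue) \<eta> where "\<delta> = \<eta> @ [Star \<alpha>]" "\<eta> \<in> P l \<alpha>" "\<eta> \<noteq> []" by auto
  then show ?case
  proof cases
    case continue
    then show ?thesis using Star.IH[of \<eta>] by auto
  qed auto
qed (auto split: if_splits)

lemma finite_P: "finite (P l \<alpha>)"
proof -
  have "P l \<alpha> \<subseteq> snd ` H \<alpha>" using P_imp_H by force
  then show ?thesis using finite_H finite_subset by blast
qed

lemma P_Int_superset: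
  assumes "tests \<alpha> \<subseteq> B"
  shows "P (l \<inter> B) \<alpha> = P l \<alpha>"
  using assms by (induction \<alpha> rule: prog_induct) simp_all

lemma X_eq: "X l \<alpha> \<psi> = Neg ` (tests \<alpha> - l) \<union> (\<lambda>\<delta>. boxes \<delta> \<psi>) ` P l \<alpha>"
  by (auto simp: X_def F_def)

lemma unfold_box_eq_range: "unfold_box \<alpha> \<psi> = range (\<lambda>l. X l \<alpha> \<psi>)"
proof -
  have "X l \<alpha> \<psi> = X (l \<inter> tests \<alpha>) \<alpha> \<psi>" for l by (auto simp: X_eq P_Int_superset)
  then show ?thesis by (auto simp: unfold_box_def)
qed

definition unfolded_rel :: "'w set \<Rightarrow> ('a \<Rightarrow> ('w \<times> 'w) set) \<Rightarrow> (('p, 'a) fm \<Rightarrow> 'w \<Rightarrow> bool)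
    \<Rightarrow> ('p, 'a) prog \<Rightarrow> ('w \<times> 'w) set" where
  "unfolded_rel S R T \<alpha> = {(w, v). \<exists>(Y, \<delta>)\<in>H \<alpha>. (\<forall>\<tau>\<in>Y. T \<tau> w) \<and> (w, v) \<in> progs_rel S R T \<delta>}"

lemma unfolded_relI:
  "(Y, \<delta>) \<in> H \<alpha> \<Longrightarrow> \<forall>\<tau>\<in>Y. T \<tau> w \<Longrightarrow> (w, v) \<in> progs_rel S R T \<delta> \<Longrightarrow> (w, v) \<in> unfolded_rel S R T \<alpha>"
  unfolding unfolded_rel_def by blast

lemma unfolded_relE:
  assumes "(w, v) \<in> unfolded_rel S R T \<alpha>"
  obtains Y \<delta> where "(Y, \<delta>) \<in> H \<alpha>" "\<forall>\<tau>\<in>Y. T \<tau> w" "(w, v) \<in> progs_rel S R T \<delta>"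
  using assms unfolding unfolded_rel_def by blast

lemma unfolded_rel_Choice:
  "unfolded_rel S R T (Choice \<alpha> \<beta>) = unfolded_rel S R T \<alpha> \<union> unfolded_rel S R T \<beta>"
  by (auto simp: unfolded_rel_def)

lemma unfolded_rel_Seq:
  assumes "(w, u) \<in> unfolded_rel S R T \<alpha>" "(u, v) \<in> unfolded_rel S R T \<beta>"
    and "(u, v) \<in> prog_rel S R T \<beta>"
  shows "(w, v) \<in> unfolded_rel S R T (Seq \<alpha> \<beta>)"
proof -
  obtain Y \<delta> where Y: "(Y, \<delta>) \<in> H \<alpha>" "\<forall>\<tau>\<in>Y. T \<tau> w" "(w, u) \<in> progs_rel S R T \<delta>"
    using assms(1) by (rule unfolded_relE)
  obtain Z \<eta> where Z: "(Z, \<eta>) \<in> H \<beta>" "\<forall>\<tau>\<in>Z. T \<tau> u" "(u, v) \<in> progs_rel S R T \<eta>"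
    using assms(2) by (rule unfolded_relE)
  show ?thesis
  proof (cases "\<delta> = []")
    case True
    then have "(Y \<union> Z, \<eta>) \<in> H (Seq \<alpha> \<beta>)" "\<forall>\<tau>\<in>Y \<union> Z. T \<tau> w" "(w, v) \<in> progs_rel S R T \<eta>"
      using Y Z by auto
    then show ?thesis by (rule unfolded_relI)
  next
    case False
    then have "(Y, \<delta> @ [\<beta>]) \<in> H (Seq \<alpha> \<beta>)" using Y(1) by auto
    moreover have "(w, v) \<in> progs_rel S R T (\<delta> @ [\<beta>])"
      using Y(3) assms(3) by (auto simp: progs_rel_append)
    ultimately show ?thesis using Y(2) by (intro unfolded_relI)
  qed
qed

lemma unfolded_rel_Star:
  assumes "(w, u) \<in> unfolded_rel S R T \<alpha>" "(u, v) \<in> unfolded_rel S R T (Star \<alpha>)"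
    and "(u, v) \<in> prog_rel S R T (Star \<alpha>)"
  shows "(w, v) \<in> unfolded_rel S R T (Star \<alpha>)"
proof -
  obtain Y \<delta> where Y: "(Y, \<delta>) \<in> H \<alpha>" "\<forall>\<tau>\<in>Y. T \<tau> w" "(w, u) \<in> progs_rel S R T \<delta>"
    using assms(1) by (rule unfolded_relE)
  show ?thesis
  proof (cases "\<delta> = []")
    case True
    then show ?thesis using Y(3) assms(2) by simp
  next
    case False
    then have "(Y, \<delta> @ [Star \<alpha>]) \<in> H (Star \<alpha>)" using Y(1) by auto
    moreover have "(w, v) \<in> progs_rel S R T (\<delta> @ [Star \<alpha>])"
      using Y(3) assms(3) by (auto simp: progs_rel_append)
    ultimately show ?thesis using Y(2) by (intro unfolded_relI)
  qed
qed

lemma prog_rel_imp_unfolded_rel: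
  assumes "(w, v) \<in> prog_rel S R T \<alpha>" and R: "\<forall>a. R a \<subseteq> S \<times> S"
  shows "(w, v) \<in> unfolded_rel S R T \<alpha>"
  using assms(1)
proof (induction \<alpha> arbitrary: w v rule: prog_induct)
  case (Seq \<alpha> \<beta>)
  from Seq.prems obtain u where "(w, u) \<in> prog_rel S R T \<alpha>" "(u, v) \<in> prog_rel S R T \<beta>" by auto
  then show ?case using Seq.IH by (blast intro: unfolded_rel_Seq)
next
  case (Star \<alpha>)
  then have "(w, v) \<in> (prog_rel S R T \<alpha>)\<^sup>*" "v \<in> S" by auto
  then show ?case
  proof (induction rule: converse_rtrancl_induct)
    case (step w u)
    then have "u \<in> S" using prog_rel_subset_Times[OF R] by blast
    then have "(u, v) \<in> prog_rel S R T (Star \<alpha>)" using step by simp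
    with Star.IH[OF step.hyps(1)] step show ?case by (blast intro: unfolded_rel_Star)
  qed (auto simp: unfolded_rel_def)
next
  case (Choice \<alpha> \<beta>)
  then show ?case by (auto simp: unfolded_rel_Choice)
qed (auto simp: unfolded_rel_def)

lemma unfolded_rel_SeqD:
  assumes "(w, v) \<in> unfolded_rel S R T (Seq \<alpha> \<beta>)"
  shows "(\<exists>u. (w, u) \<in> unfolded_rel S R T \<alpha> \<and> (u, v) \<in> prog_rel S R T \<beta>) \<or>
    (w, w) \<in> unfolded_rel S R T \<alpha> \<and> (w, v) \<in> unfolded_rel S R T \<beta>"
proof -
  obtain Y \<delta> where Y: "(Y, \<delta>) \<in> H (Seq \<alpha> \<beta>)" "\<forall>\<tau>\<in>Y. T \<tau> w" "(w, v) \<in> progs_rel S R T \<delta>"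
    using assms by (rule unfolded_relE)
  from Y(1) consider (head) \<eta> where "\<delta> = \<eta> @ [\<beta>]" "(Y, \<eta>) \<in> H \<alpha>"
    | (tail) Y' Z where "Y = Y' \<union> Z" "(Y', []) \<in> H \<alpha>" "(Z, \<delta>) \<in> H \<beta>" by auto
  then show ?thesis
  proof cases
    case head
    with Y(3) obtain u where u: "(w, u) \<in> progs_rel S R T \<eta>" "(u, v) \<in> prog_rel S R T \<beta>"
      by (auto simp: progs_rel_append)
    then show ?thesis using unfolded_relI[OF head(2) Y(2) u(1)] by blast
  next
    case tail
    then show ?thesis using Y(2,3) by (auto intro: unfolded_relI)
  qed
qed

lemma unfolded_rel_StarD:
  assumes "(w, v) \<in> unfolded_rel S R T (Star \<alpha>)"
  shows "w = v \<or> (\<exists>u. (w, u) \<in> unfolded_rel S R T \<alpha> \<and> (u, v) \<in> prog_rel S R T (Star \<alpha>))"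
proof -
  obtain Y \<delta> where Y: "(Y, \<delta>) \<in> H (Star \<alpha>)" "\<forall>\<tau>\<in>Y. T \<tau> w" "(w, v) \<in> progs_rel S R T \<delta>"
    using assms by (rule unfolded_relE)
  from Y(1) consider (stop) "\<delta> = []" | (continue) \<eta> where "\<delta> = \<eta> @ [Star \<alpha>]" "(Y, \<eta>) \<in> H \<alpha>"
    by auto
  then show ?thesis
  proof cases
    case stop
    then show ?thesis using Y(3) by simp
  next
    case continue
    with Y(3) obtain u where u: "(w, u) \<in> progs_rel S R T \<eta>" "(u, v) \<in> prog_rel S R T (Star \<alpha>)"
      by (auto simp: progs_rel_append)
    then show ?thesis using unfolded_relI[OF continue(2) Y(2) u(1)] by blast
  qed
qed

lemma unfolded_rel_imp_prog_rel:
  assumes "(w, v) \<in> unfolded_rel S R T \<alpha>" and w: "w \<in> S"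
  shows "(w, v) \<in> prog_rel S R T \<alpha>"
  using assms(1)
proof (induction \<alpha> arbitrary: v rule: prog_induct)
  case (Choice \<alpha> \<beta>)
  then show ?case by (auto simp: unfolded_rel_Choice)
next
  case (Seq \<alpha> \<beta>)
  from unfolded_rel_SeqD[OF Seq.prems] show ?case using Seq.IH by auto
next
  case (Star \<alpha>)
  from unfolded_rel_StarD[OF Star.prems] show ?case
    using Star.IH w by (auto intro: converse_rtrancl_into_rtrancl)
qed (use w in \<open>auto simp: unfolded_rel_def\<close>)

section \<open>Unloading\<close>

primrec unload_box :: "('p, 'a) lbox \<Rightarrow> ('p, 'a) fm" where
  "unload_box (Plain \<phi>) = \<phi>"
| "unload_box (LBox \<alpha> \<xi>) = Box \<alpha> (unload_box \<xi>)"

primrec unload :: "('p, 'a) sfm \<Rightarrow> ('p, 'a) fm" where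
  "unload (Free \<phi>) = \<phi>"
| "unload (Loaded \<alpha> \<xi>) = Neg (Box \<alpha> (unload_box \<xi>))"

primrec lbox_progs :: "('p, 'a) lbox \<Rightarrow> ('p, 'a) prog list" where
  "lbox_progs (Plain \<phi>) = []"
| "lbox_progs (LBox \<alpha> \<xi>) = \<alpha> # lbox_progs \<xi>"

primrec lbox_core :: "('p, 'a) lbox \<Rightarrow> ('p, 'a) fm" where
  "lbox_core (Plain \<phi>) = \<phi>"
| "lbox_core (LBox \<alpha> \<xi>) = lbox_core \<xi>"

lemma unload_box_lboxes [simp]: "unload_box (lboxes \<delta> \<xi>) = boxes \<delta> (unload_box \<xi>)"
  by (induction \<delta>) auto

lemma lbox_progs_lboxes [simp]: "lbox_progs (lboxes \<delta> \<xi>) = \<delta> @ lbox_progs \<xi>"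
  by (induction \<delta>) auto

lemma lbox_core_lboxes [simp]: "lbox_core (lboxes \<delta> \<xi>) = lbox_core \<xi>"
  by (induction \<delta>) auto

lemma lboxes_progs_core: "lboxes (lbox_progs \<xi>) (Plain (lbox_core \<xi>)) = \<xi>"
  by (induction \<xi>) auto

lemma unload_box_eq_boxes: "unload_box \<xi> = boxes (lbox_progs \<xi>) (lbox_core \<xi>)"
  by (induction \<xi>) auto

lemma size_lbox:
  "size (lbox_core \<xi>) \<le> size (unload_box \<xi>)"
  "\<alpha> \<in> set (lbox_progs \<xi>) \<Longrightarrow> size \<alpha> < size (unload_box \<xi>)"
  by (induction \<xi>) auto

lemma maximal_unload_box: "\<exists>\<xi>. unload_box \<xi> = \<phi> \<and> (\<nexists>\<beta> \<psi>. lbox_core \<xi> = Box \<beta> \<psi>)"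
proof (induction \<phi> rule: fm.induct[of _ "\<lambda>_. True", case_names Bot Var Neg Con Box])
  case (Box \<alpha> \<phi>)
  then obtain \<xi> where "unload_box \<xi> = \<phi>" "\<nexists>\<beta> \<psi>. lbox_core \<xi> = Box \<beta> \<psi>" by blast
  then show ?case by (intro exI[of _ "LBox \<alpha> \<xi>"]) simp
qed (auto intro: exI[of _ "Plain _"])

lemma unload_lneg [simp]: "unload (lneg \<xi>) = Neg (unload_box \<xi>)"
  by (cases \<xi>) auto

lemma unload_Free_image [simp]: "unload ` Free ` Y = Y"
  by (simp add: image_image)

lemma unload_box_eq_iff:
  "unload_box \<xi> = \<phi> \<longleftrightarrow> \<xi> = Plain \<phi> \<or> (\<exists>\<alpha> \<zeta>. \<xi> = LBox \<alpha> \<zeta> \<and> \<phi> = Box \<alpha> (unload_box \<zeta>))"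
  by (cases \<xi>) auto

lemma finite_unload_box_vimage_singleton: "finite (unload_box -` {\<phi>})"
proof (induction \<phi> rule: fm.induct[of _ "\<lambda>_. True", case_names Bot Var Neg Con Box])
  case (Box \<alpha> \<phi>)
  have "unload_box -` {Box \<alpha> \<phi>} \<subseteq> insert (Plain (Box \<alpha> \<phi>)) (LBox \<alpha> ` (unload_box -` {\<phi>}))"
    by (auto simp: unload_box_eq_iff[of _ "Box \<alpha> \<phi>"])
  then show ?case using Box by (auto intro: finite_subset)
qed (simp_all add: vimage_def unload_box_eq_iff)

lemma finite_unload_box_vimage:
  assumes "finite B"
  shows "finite (unload_box -` B)"
proof -
  have "finite (unload_box -` B \<inter> UNIV)"
    by (rule finite_finite_vimage_IntI[OF assms]) (simp add: finite_unload_box_vimage_singleton)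
  then show ?thesis by simp
qed

lemma finite_unload_vimage:
  assumes "finite C"
  shows "finite (unload -` C)"
proof -
  have "finite (unload_box -` Neg -` C)"
    by (intro finite_unload_box_vimage finite_vimageI assms) (simp add: inj_def)
  moreover have "unload -` C \<subseteq> Free ` C \<union> lneg ` (unload_box -` Neg -` C)"
  proof
    fix f assume "f \<in> unload -` C"
    then show "f \<in> Free ` C \<union> lneg ` (unload_box -` Neg -` C)"
      by (cases f) (auto intro: image_eqI[of _ lneg "LBox _ _"])
  qed
  ultimately show ?thesis using assms by (meson finite_UnI finite_imageI finite_subset)
qed

lemma loaded_Un [simp]: "loaded (\<Delta> \<union> \<Gamma>) \<longleftrightarrow> loaded \<Delta> \<or> loaded \<Gamma>"
  by (auto simp: loaded_def)

lemma loaded_insert [simp]: "loaded (insert f \<Gamma>) \<longleftrightarrow> (\<exists>\<alpha> \<xi>. f = Loaded \<alpha> \<xi>) \<or> loaded \<Gamma>"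
  by (auto simp: loaded_def)

lemma not_loaded [simp]: "\<not> loaded (Free ` Y)" "\<not> loaded (proj a \<Delta>)"
  by (auto simp: loaded_def proj_def)

lemma basic_imp_not_loaded: "basic \<Delta> \<Longrightarrow> \<not> loaded \<Delta>"
  by (force simp: loaded_def basic_def)

section \<open>Expansions\<close>

abbreviation basic_fm :: "('p, 'a) fm \<Rightarrow> bool" where
  "basic_fm \<phi> \<equiv> basic {Free \<phi>}"

lemma basic_fm_simps [simp]:
  "basic_fm Bot" "basic_fm (Neg Bot)" "basic_fm (Var p)" "basic_fm (Neg (Var p))"
  "\<not> basic_fm (Neg (Neg \<phi>))" "\<not> basic_fm (Con \<phi> \<psi>)" "\<not> basic_fm (Neg (Con \<phi> \<psi>))"
  "basic_fm (Box \<alpha> \<phi>) \<longleftrightarrow> atomic \<alpha>" "basic_fm (Neg (Box \<alpha> \<phi>)) \<longleftrightarrow> atomic \<alpha>"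
  by (auto simp: basic_def atomic_def)

lemma basic_iff: "basic \<Gamma> \<longleftrightarrow> \<not> loaded \<Gamma> \<and> (\<forall>\<phi>. Free \<phi> \<in> \<Gamma> \<longrightarrow> basic_fm \<phi>)"
  for \<Gamma> :: "('p, 'a) sequent"
proof -
  have "basic \<Gamma> \<longleftrightarrow> (\<forall>f\<in>\<Gamma>. basic {f})" by (auto simp: basic_def)
  moreover have "\<not> basic {Loaded \<alpha> \<xi>}" for \<alpha> and \<xi> :: "('p, 'a) lbox" by (simp add: basic_def)
  ultimately show ?thesis unfolding loaded_def by (metis sfm.exhaust)
qed

fun expansions :: "('p, 'a) fm \<Rightarrow> ('p, 'a) fm set set" where
  "expansions (Neg (Neg \<phi>)) = {{\<phi>}}"
| "expansions (Con \<phi> \<psi>) = {{\<phi>, \<psi>}}"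
| "expansions (Neg (Con \<phi> \<psi>)) = {{Neg \<phi>}, {Neg \<psi>}}"
| "expansions (Box \<alpha> \<psi>) = unfold_box \<alpha> \<psi>"
| "expansions (Neg (Box \<alpha> \<psi>)) = unfold_dia \<alpha> \<psi>"
| "expansions \<phi> = {{\<phi>}}"

lemma expansion_cases [case_names Neg_Neg Con Neg_Con Box Neg_Box literal]:
  obtains \<psi> where "\<phi> = Neg (Neg \<psi>)" | \<psi> \<chi> where "\<phi> = Con \<psi> \<chi>" | \<psi> \<chi> where "\<phi> = Neg (Con \<psi> \<chi>)"
  | \<alpha> \<psi> where "\<phi> = Box \<alpha> \<psi>" | \<alpha> \<psi> where "\<phi> = Neg (Box \<alpha> \<psi>)"
  | "basic_fm \<phi>" "expansions \<phi> = {{\<phi>}}"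
  by (cases \<phi> rule: expansions.cases) simp_all

primrec sfm_expansions :: "('p, 'a) sfm \<Rightarrow> ('p, 'a) sequent set" where
  "sfm_expansions (Free \<phi>) = image Free ` expansions \<phi>"
| "sfm_expansions (Loaded \<alpha> \<xi>) = unfold_ldia \<alpha> \<xi>"

lemma unfold_dia_eq_image: "unfold_dia \<alpha> \<psi> = (\<lambda>(Y, \<delta>). Y \<union> {Neg (boxes \<delta> \<psi>)}) ` H \<alpha>"
  by (auto simp: unfold_dia_def)

lemma unfold_ldia_eq_image: "unfold_ldia \<alpha> \<xi> = (\<lambda>(Y, \<delta>). Free ` Y \<union> {lneg (lboxes \<delta> \<xi>)}) ` H \<alpha>"
  by (auto simp: unfold_ldia_def)

lemma unload_sfm_expansions: "image unload ` sfm_expansions f = expansions (unload f)"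
  by (cases f)
    (auto simp: image_image image_Un unfold_dia_eq_image unfold_ldia_eq_image split_def)

lemma expansions_basic:
  assumes "basic_fm \<phi>"
  shows "expansions \<phi> = {{\<phi>}}"
  using assms
proof (cases \<phi> rule: expansion_cases)
  case (Box \<alpha> \<psi>)
  then show ?thesis using assms by (auto simp: atomic_def unfold_box_eq_range X_eq)
next
  case (Neg_Box \<alpha> \<psi>)
  then show ?thesis using assms by (auto simp: atomic_def unfold_dia_def)
qed auto

lemma expansions_nonempty: "expansions \<phi> \<noteq> {}"
  by (cases \<phi> rule: expansion_cases)
    (auto simp: unfold_dia_eq_image H_nonempty unfold_box_eq_range)

lemma finite_X: "finite (X l \<alpha> \<psi>)"
  by (simp add: X_eq finite_tests finite_P)

lemma finite_expansions:
  fixes \<phi> :: "('p, 'a) fm"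
  shows "finite (expansions \<phi>)" and "Y \<in> expansions \<phi> \<Longrightarrow> finite Y"
proof -
  show "finite (expansions \<phi>)"
    by (cases \<phi> rule: expansion_cases)
      (simp_all add: unfold_dia_eq_image finite_H unfold_box_def finite_tests)
  have "finite Y" if "(Y, \<delta>) \<in> H \<alpha>" for Y \<delta> and \<alpha> :: "('p, 'a) prog"
    using H_tests[OF that] finite_tests finite_subset by blast
  then show "finite Y" if "Y \<in> expansions \<phi>"
    using that
    by (cases \<phi> rule: expansion_cases) (auto simp: unfold_dia_def unfold_box_def finite_X)
qed

lemma sat_imp_sat_unfold_box:
  assumes M: "kripke_model M" and w: "w \<in> states M" and \<psi>: "sat M (Box \<alpha> \<psi>) w"
  shows "\<exists>Y\<in>unfold_box \<alpha> \<psi>. \<forall>\<chi>\<in>Y. sat M \<chi> w"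
proof -
  define l where "l = {\<tau>. sat M \<tau> w}"
  have "sat M (boxes \<delta> \<psi>) w" if \<delta>: "\<delta> \<in> P l \<alpha>" for \<delta>
  proof -
    obtain Y where "Y \<subseteq> l" "(Y, \<delta>) \<in> H \<alpha>" using P_imp_H[OF \<delta>] by blast
    then have "prels M \<delta> `` {w} \<subseteq> unfolded_rel (states M) (acc M) (sat M) \<alpha> `` {w}"
      by (auto simp: l_def intro: unfolded_relI)
    also have "\<dots> \<subseteq> prel M \<alpha> `` {w}"
      unfolding prel_eq_prog_rel using unfolded_rel_imp_prog_rel[OF _ w] by blast
    finally show ?thesis using \<psi> by (auto simp: sat_boxes)
  qed
  then have "\<forall>\<chi>\<in>X l \<alpha> \<psi>. sat M \<chi> w" by (auto simp: X_eq l_def)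
  then show ?thesis by (auto simp: unfold_box_eq_range)
qed

lemma sat_imp_sat_unfold_dia:
  assumes M: "kripke_model M" and "sat M (Neg (Box \<alpha> \<psi>)) w"
  shows "\<exists>Y\<in>unfold_dia \<alpha> \<psi>. \<forall>\<chi>\<in>Y. sat M \<chi> w"
proof -
  obtain v where v: "(w, v) \<in> prog_rel (states M) (acc M) (sat M) \<alpha>" "\<not> sat M \<psi> v"
    using assms(2) by (auto simp: prel_eq_prog_rel)
  obtain Y \<delta> where Y: "(Y, \<delta>) \<in> H \<alpha>" "\<forall>\<tau>\<in>Y. sat M \<tau> w" "(w, v) \<in> prels M \<delta>"
    using prog_rel_imp_unfolded_rel[OF v(1) kripke_model_acc[OF M]] by (rule unfolded_relE)
  then have "\<forall>\<chi>\<in>Y \<union> {Neg (boxes \<delta> \<psi>)}. sat M \<chi> w" using v(2) by (auto simp: sat_boxes)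
  then show ?thesis using Y(1) unfolding unfold_dia_def by blast
qed

lemma sat_imp_sat_expansion:
  assumes "kripke_model M" "w \<in> states M" "sat M \<phi> w"
  shows "\<exists>Y\<in>expansions \<phi>. \<forall>\<chi>\<in>Y. sat M \<chi> w"
  using sat_imp_sat_unfold_box[OF assms(1,2)] sat_imp_sat_unfold_dia[OF assms(1)] assms(3)
  by (cases \<phi> rule: expansion_cases) simp_all

text \<open>Only boxes of non-atomic programs can be expanded, hence the weight \<open>0\<close> of the others.\<close>

primrec weight :: "('p, 'a) fm \<Rightarrow> nat" and prog_weight :: "('p, 'a) prog \<Rightarrow> nat" where
  "weight Bot = 0"
| "weight (Var p) = 0"
| "weight (Neg \<phi>) = Suc (weight \<phi>)"
| "weight (Con \<phi> \<psi>) = 2 + weight \<phi> + weight \<psi>"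
| "weight (Box \<alpha> \<phi>) = (if atomic \<alpha> then 0 else 2 + prog_weight \<alpha> + weight \<phi>)"
| "prog_weight (Atom a) = 0"
| "prog_weight (Test \<tau>) = weight \<tau>"
| "prog_weight (Choice \<alpha> \<beta>) = prog_weight \<alpha> + prog_weight \<beta>"
| "prog_weight (Seq \<alpha> \<beta>) = prog_weight \<alpha> + prog_weight \<beta>"
| "prog_weight (Star \<alpha>) = prog_weight \<alpha>"

lemma weight_tests: "\<tau> \<in> tests \<alpha> \<Longrightarrow> weight \<tau> \<le> prog_weight \<alpha>"
  by (induction \<alpha> rule: prog_induct) auto

lemma weight_boxes_H: "(Y, \<delta>) \<in> H \<alpha> \<Longrightarrow> weight (boxes \<delta> \<psi>) \<le> weight \<psi>"
  by (drule H_head) (auto simp: atomic_def)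

lemma weight_expansion_less:
  assumes "Y \<in> expansions \<phi>" "\<not> basic_fm \<phi>" "\<chi> \<in> Y"
  shows "weight \<chi> < weight \<phi>"
  using assms
proof (cases \<phi> rule: expansion_cases)
  case (Box \<alpha> \<psi>)
  then obtain l where "\<chi> \<in> X l \<alpha> \<psi>" using assms by (auto simp: unfold_box_def)
  then consider (test) \<tau> where "\<tau> \<in> tests \<alpha>" "\<chi> = Neg \<tau>"
    | (path) \<delta> where "\<delta> \<in> P l \<alpha>" "\<chi> = boxes \<delta> \<psi>" by (auto simp: X_eq)
  then show ?thesis
  proof cases
    case test
    then show ?thesis using weight_tests[of \<tau> \<alpha>] Box assms(2) by simp
  next
    case path
    then have "weight \<chi> \<le> weight \<psi>" using P_imp_H weight_boxes_H by blast
    then show ?thesis using Box assms(2) by simp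
  qed
next
  case (Neg_Box \<alpha> \<psi>)
  then obtain Z \<delta> where Z: "Y = Z \<union> {Neg (boxes \<delta> \<psi>)}" "(Z, \<delta>) \<in> H \<alpha>"
    using assms(1) by (auto simp: unfold_dia_def)
  then have "weight \<tau> \<le> prog_weight \<alpha>" if "\<tau> \<in> Z" for \<tau>
    using H_tests[OF Z(2)] weight_tests that by blast
  then show ?thesis using Z(1) Neg_Box assms(2,3) weight_boxes_H[OF Z(2), of \<psi>] by fastforce
qed auto

definition weights :: "('p, 'a) sequent \<Rightarrow> nat multiset" where
  "weights \<Gamma> = image_mset (weight \<circ> unload) (mset_set \<Gamma>)"

lemma weights_replace:
  assumes "finite \<Delta>" "finite G" "f \<notin> \<Delta>" "\<And>g. g \<in> G \<Longrightarrow> weight (unload g) < weight (unload f)"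
  shows "(weights (\<Delta> \<union> G), weights (\<Delta> \<union> {f})) \<in> mult less_than"
proof -
  have "mset_set (\<Delta> \<union> G) = mset_set \<Delta> + mset_set (G - \<Delta>)"
    using assms(1,2) by (subst mset_set_Union[symmetric]) auto
  then have "weights (\<Delta> \<union> G) = weights \<Delta> + weights (G - \<Delta>)" by (simp add: weights_def)
  moreover have "weights (\<Delta> \<union> {f}) = weights \<Delta> + {#weight (unload f)#}"
    using assms(1,3) by (simp add: weights_def)
  moreover have "(weights \<Delta> + weights (G - \<Delta>), weights \<Delta> + {#weight (unload f)#}) \<in> mult less_than"
    by (rule one_step_implies_mult) (use assms in \<open>auto simp: weights_def\<close>)
  ultimately show ?thesis by simp
qed

lemma sfm_expansions_unload: "\<Gamma> \<in> sfm_expansions f \<Longrightarrow> unload ` \<Gamma> \<in> expansions (unload f)"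
  unfolding unload_sfm_expansions[symmetric] by (rule imageI)

lemma finite_sfm_expansions:
  shows "finite (sfm_expansions f)" and "\<Gamma> \<in> sfm_expansions f \<Longrightarrow> finite \<Gamma>"
proof -
  show "finite (sfm_expansions f)"
    by (cases f) (simp_all add: finite_expansions unfold_ldia_eq_image finite_H)
  show "finite \<Gamma>" if "\<Gamma> \<in> sfm_expansions f"
  proof (rule finite_subset)
    show "\<Gamma> \<subseteq> unload -` unload ` \<Gamma>" by blast
    show "finite (unload -` unload ` \<Gamma>)"
      using finite_expansions(2)[OF sfm_expansions_unload[OF that]] by (rule finite_unload_vimage)
  qed
qed

lemma weights_expansion_less:
  assumes "finite \<Delta>" "f \<notin> \<Delta>" "\<not> basic_fm (unload f)" "\<Gamma> \<in> sfm_expansions f"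
  shows "(weights (\<Delta> \<union> \<Gamma>), weights (\<Delta> \<union> {f})) \<in> mult less_than"
proof (rule weights_replace[OF assms(1) finite_sfm_expansions(2)[OF assms(4)] assms(2)])
  show "weight (unload g) < weight (unload f)" if "g \<in> \<Gamma>" for g
    using weight_expansion_less[OF sfm_expansions_unload[OF assms(4)] assms(3)] that by blast
qed

section \<open>Rule instances\<close>

lemma expansion_rule_inst:
  assumes "f \<notin> \<Delta>" "\<not> basic_fm (unload f)"
  shows "\<exists>r. rule_inst r (\<Delta> \<union> {f}) ((\<union>) \<Delta> ` sfm_expansions f)"
proof (cases f)
  case (Free \<phi>)
  have image_eq: "(\<union>) \<Delta> ` image Free ` Ys = {\<Delta> \<union> Free ` Y | Y. Y \<in> Ys}" for Ys by auto
  have "Free \<phi> \<notin> \<Delta>" "\<not> basic_fm \<phi>" using assms Free by simp_all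
  then have "\<exists>r. rule_inst r (\<Delta> \<union> {Free \<phi>}) ((\<union>) \<Delta> ` image Free ` expansions \<phi>)"
  proof (cases \<phi> rule: expansion_cases)
    case (Box \<alpha> \<psi>)
    then show ?thesis using assms rule_inst.box[of \<alpha> \<psi> \<Delta>] by (auto simp: Free image_eq)
  next
    case (Neg_Box \<alpha> \<psi>)
    then show ?thesis using assms rule_inst.dia[of \<alpha> \<psi> \<Delta>] by (auto simp: Free image_eq)
  qed (auto intro: rule_inst.intros simp del: Un_insert_right)
  then show ?thesis by (simp add: Free)
next
  case (Loaded \<alpha> \<xi>)
  have "(\<union>) \<Delta> ` sfm_expansions f = {\<Delta> \<union> \<Gamma> | \<Gamma>. \<Gamma> \<in> unfold_ldia \<alpha> \<xi>}" by (auto simp: Loaded)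
  then show ?thesis using assms rule_inst.ldia[of \<alpha> \<xi> \<Delta>] unfolding Loaded by auto
qed

lemma expansion_rule_inst_Free:
  assumes "Free \<phi> \<in> \<Gamma>" "\<not> basic_fm \<phi>"
  obtains r where "rule_inst r \<Gamma> {\<Gamma> - {Free \<phi>} \<union> Free ` Y | Y. Y \<in> expansions \<phi>}"
proof -
  have "(\<union>) (\<Gamma> - {Free \<phi>}) ` sfm_expansions (Free \<phi>) =
      {\<Gamma> - {Free \<phi>} \<union> Free ` Y | Y. Y \<in> expansions \<phi>}" by auto
  moreover have "\<Gamma> - {Free \<phi>} \<union> {Free \<phi>} = \<Gamma>" using assms(1) by blast
  ultimately show ?thesis
    using expansion_rule_inst[of "Free \<phi>" "\<Gamma> - {Free \<phi>}"] assms(2) that by auto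
qed

lemma rule_inst_cases [consumes 1, case_names expansion lplus lminus modal]:
  assumes "rule_inst r \<Gamma> G"
  obtains \<Delta> f where "\<Gamma> = \<Delta> \<union> {f}" "f \<notin> \<Delta>" "\<not> basic_fm (unload f)" "G = (\<union>) \<Delta> ` sfm_expansions f"
  | \<Delta> a \<delta> \<phi> where "r = RLPlus" "\<Gamma> = \<Delta> \<union> {Free (Neg (Box (Atom a) (boxes \<delta> \<phi>)))}"
      "G = {\<Delta> \<union> {Loaded (Atom a) (lboxes \<delta> (Plain \<phi>))}}" "basic \<Delta>"
  | \<Delta> \<delta> \<phi> where "r = RLMinus" "\<Gamma> = \<Delta> \<union> {lneg (lboxes \<delta> (Plain \<phi>))}"
      "G = {\<Delta> \<union> {Free (Neg (boxes \<delta> \<phi>))}}" "basic \<Delta>"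
  | \<Delta> a \<xi> where "r = RM" "\<Gamma> = \<Delta> \<union> {Loaded (Atom a) \<xi>}" "G = {proj a \<Delta> \<union> {lneg \<xi>}}" "basic \<Delta>"
  using assms
proof cases
  case (neg \<phi> \<Delta>)
  then show ?thesis by (intro that(1)[of \<Delta> "Free (Neg (Neg \<phi>))"]) auto
next
  case (con \<phi> \<psi> \<Delta>)
  then show ?thesis by (intro that(1)[of \<Delta> "Free (Con \<phi> \<psi>)"]) auto
next
  case (neg_con \<phi> \<psi> \<Delta>)
  then show ?thesis by (intro that(1)[of \<Delta> "Free (Neg (Con \<phi> \<psi>))"]) auto
next
  case (box \<alpha> \<phi> \<Delta>)
  then show ?thesis by (intro that(1)[of \<Delta> "Free (Box \<alpha> \<phi>)"]) auto
next
  case (dia \<alpha> \<phi> \<Delta>)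
  then show ?thesis by (intro that(1)[of \<Delta> "Free (Neg (Box \<alpha> \<phi>))"]) auto
next
  case (ldia \<alpha> \<xi> \<Delta>)
  then show ?thesis by (intro that(1)[of \<Delta> "Loaded \<alpha> \<xi>"]) auto
qed (use that in blast)+

lemma rule_inst_nonempty: "rule_inst r \<Gamma> G \<Longrightarrow> G \<noteq> {}"
proof (induction rule: rule_inst_cases)
  case (expansion \<Delta> f)
  then show ?case using expansions_nonempty[of "unload f"] by (simp flip: unload_sfm_expansions)
qed auto

lemma finite_proj:
  assumes "finite \<Delta>"
  shows "finite (proj a \<Delta>)"
proof -
  have "proj a \<Delta> = Free ` ((\<lambda>\<phi>. Free (Box (Atom a) \<phi>)) -` \<Delta>)" by (auto simp: proj_def)
  then show ?thesis using assms by (simp add: finite_vimageI inj_def)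
qed

lemma rule_inst_finite:
  assumes "rule_inst r \<Gamma> G" "finite \<Gamma>"
  shows "finite G" and "\<Gamma>' \<in> G \<Longrightarrow> finite \<Gamma>'"
proof -
  have "finite G \<and> (\<forall>\<Gamma>'\<in>G. finite \<Gamma>')"
    using assms by (cases rule: rule_inst_cases) (auto simp: finite_sfm_expansions finite_proj)
  then show "finite G" "\<Gamma>' \<in> G \<Longrightarrow> finite \<Gamma>'" by auto
qed

section \<open>Fischer--Ladner closure\<close>

fun fl :: "('p, 'a) fm \<Rightarrow> ('p, 'a) fm set"
  and fl_box :: "('p, 'a) prog \<Rightarrow> ('p, 'a) fm \<Rightarrow> ('p, 'a) fm set" where
  "fl Bot = {Bot}"
| "fl (Var p) = {Var p}"
| "fl (Neg \<phi>) = insert (Neg \<phi>) (fl \<phi>)"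
| "fl (Con \<phi> \<psi>) = insert (Con \<phi> \<psi>) (fl \<phi> \<union> fl \<psi>)"
| "fl (Box \<alpha> \<phi>) = fl_box \<alpha> \<phi> \<union> fl \<phi>"
| "fl_box (Atom a) \<psi> = {Box (Atom a) \<psi>}"
| "fl_box (Test \<tau>) \<psi> = insert (Box (Test \<tau>) \<psi>) (fl \<tau>)"
| "fl_box (Choice \<alpha> \<beta>) \<psi> = insert (Box (Choice \<alpha> \<beta>) \<psi>) (fl_box \<alpha> \<psi> \<union> fl_box \<beta> \<psi>)"
| "fl_box (Seq \<alpha> \<beta>) \<psi> = insert (Box (Seq \<alpha> \<beta>) \<psi>) (fl_box \<alpha> (Box \<beta> \<psi>) \<union> fl_box \<beta> \<psi>)"
| "fl_box (Star \<alpha>) \<psi> = insert (Box (Star \<alpha>) \<psi>) (fl_box \<alpha> (Box (Star \<alpha>) \<psi>))"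

fun fl_succ :: "('p, 'a) fm \<Rightarrow> ('p, 'a) fm set" where
  "fl_succ (Neg \<phi>) = {\<phi>}"
| "fl_succ (Con \<phi> \<psi>) = {\<phi>, \<psi>}"
| "fl_succ (Box (Atom a) \<psi>) = {\<psi>}"
| "fl_succ (Box (Test \<tau>) \<psi>) = {\<tau>, \<psi>}"
| "fl_succ (Box (Choice \<alpha> \<beta>) \<psi>) = {Box \<alpha> \<psi>, Box \<beta> \<psi>, \<psi>}"
| "fl_succ (Box (Seq \<alpha> \<beta>) \<psi>) = {Box \<alpha> (Box \<beta> \<psi>), Box \<beta> \<psi>, \<psi>}"
| "fl_succ (Box (Star \<alpha>) \<psi>) = {Box \<alpha> (Box (Star \<alpha>) \<psi>), \<psi>}"
| "fl_succ _ = {}"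

definition fl_closed :: "('p, 'a) fm set \<Rightarrow> bool" where
  "fl_closed K \<longleftrightarrow> (\<forall>\<chi>\<in>K. fl_succ \<chi> \<subseteq> K)"

lemma fl_box_self: "Box \<alpha> \<psi> \<in> fl_box \<alpha> \<psi>"
  by (cases \<alpha>) auto

lemma fl_self: "\<phi> \<in> fl \<phi>"
  by (cases \<phi>) (auto simp: fl_box_self)

lemma finite_fl: "finite (fl \<phi>)" and finite_fl_box: "finite (fl_box \<alpha> \<psi>)"
  for \<phi> \<psi> :: "('p, 'a) fm"
  by (induction \<phi> and \<alpha> \<psi> rule: fl_fl_box.induct) auto

lemma fl_succ_fl: "\<chi> \<in> fl \<phi> \<Longrightarrow> fl_succ \<chi> \<subseteq> fl \<phi>"
  and fl_succ_fl_box: "\<chi> \<in> fl_box \<alpha> \<psi> \<Longrightarrow> fl_succ \<chi> \<subseteq> insert \<psi> (fl_box \<alpha> \<psi>)"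
  for \<phi> \<psi> :: "('p, 'a) fm"
proof (induction \<phi> and \<alpha> arbitrary: \<chi> and \<chi> \<psi> rule: fm.induct prog.induct)
  case (Neg \<phi>)
  then show ?case using fl_self[of \<phi>] by fastforce
next
  case (Con \<phi> \<psi>)
  then show ?case using fl_self[of \<phi>] fl_self[of \<psi>] by fastforce
next
  case (Box \<alpha> \<phi>)
  then show ?case using fl_self[of \<phi>] by fastforce
next
  case (Test \<tau>)
  then show ?case using fl_self[of \<tau>] by fastforce
next
  case (Choice \<alpha> \<beta>)
  then show ?case using fl_box_self[of \<alpha> \<psi>] fl_box_self[of \<beta> \<psi>] by fastforce
next
  case (Seq \<alpha> \<beta>)
  then show ?case using fl_box_self[of \<alpha> "Box \<beta> \<psi>"] fl_box_self[of \<beta> \<psi>] by fastforce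
next
  case (Star \<alpha>)
  then show ?case using fl_box_self[of \<alpha> "Box (Star \<alpha>) \<psi>"] by fastforce
qed auto

lemma fl_closed_UN_fl: "fl_closed (\<Union>\<phi>\<in>\<Phi>. fl \<phi>)"
  using fl_succ_fl unfolding fl_closed_def by blast

lemma fl_closedD: "fl_closed K \<Longrightarrow> \<chi> \<in> K \<Longrightarrow> fl_succ \<chi> \<subseteq> K"
  by (simp add: fl_closed_def)

lemma fl_closed_tail:
  assumes "fl_closed K" "Box \<alpha> \<psi> \<in> K"
  shows "\<psi> \<in> K"
  using fl_closedD[OF assms] by (cases \<alpha>) simp_all

lemma fl_closed_tests:
  assumes "fl_closed K" "Box \<alpha> \<psi> \<in> K"
  shows "tests \<alpha> \<subseteq> K"
  using assms(2)
proof (induction \<alpha> arbitrary: \<psi> rule: prog_induct)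
  case (Test \<tau>)
  then show ?case using fl_closedD[OF assms(1) Test] by simp
next
  case (Choice \<alpha> \<beta>)
  then show ?case using fl_closedD[OF assms(1) Choice.prems] Choice.IH[of \<psi>] by simp
next
  case (Seq \<alpha> \<beta>)
  then show ?case
    using fl_closedD[OF assms(1) Seq.prems] Seq.IH(1)[of "Box \<beta> \<psi>"] Seq.IH(2)[of \<psi>] by simp
next
  case (Star \<alpha>)
  then show ?case
    using fl_closedD[OF assms(1) Star.prems] Star.IH[of "Box (Star \<alpha>) \<psi>"] by simp
qed simp

lemma fl_closed_boxes:
  assumes "fl_closed K" "Box \<alpha> \<psi> \<in> K" "(Y, \<delta>) \<in> H \<alpha>"
  shows "boxes \<delta> \<psi> \<in> K"
  using assms(2,3)
proof (induction \<alpha> arbitrary: Y \<delta> \<psi> rule: prog_induct)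
  case (Test \<tau>)
  then show ?case using fl_closed_tail[OF assms(1) Test(1)] by simp
next
  case (Choice \<alpha> \<beta>)
  then show ?case using fl_closedD[OF assms(1) Choice.prems(1)] Choice.IH[of \<psi> Y \<delta>] by auto
next
  case (Seq \<alpha> \<beta>)
  then show ?case
    using fl_closedD[OF assms(1) Seq.prems(1)] Seq.IH(1)[of "Box \<beta> \<psi>"] Seq.IH(2)[of \<psi>] by auto
next
  case (Star \<alpha>)
  then show ?case
    using fl_closedD[OF assms(1) Star.prems(1)] Star.IH[of "Box (Star \<alpha>) \<psi>"] by auto
qed simp

lemma fl_closed_expansions:
  assumes K: "fl_closed K" and \<phi>: "\<phi> \<in> K \<union> Neg ` K" and Y: "Y \<in> expansions \<phi>"
  shows "Y \<subseteq> K \<union> Neg ` K"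
proof -
  have Neg: "\<chi> \<in> K" if "Neg \<chi> \<in> K \<union> Neg ` K" for \<chi>
    using that fl_closedD[OF K, of "Neg \<chi>"] by auto
  show ?thesis
  proof (cases \<phi> rule: expansion_cases)
    case (Neg_Neg \<psi>)
    then have "\<psi> \<in> K" using \<phi> Neg[of \<psi>] Neg[of "Neg \<psi>"] by blast
    then show ?thesis using Y Neg_Neg by simp
  next
    case (Con \<psi> \<chi>)
    then show ?thesis using \<phi> Y fl_closedD[OF K, of \<phi>] by auto
  next
    case (Neg_Con \<psi> \<chi>)
    then have "Con \<psi> \<chi> \<in> K" using \<phi> Neg[of "Con \<psi> \<chi>"] by simp
    then show ?thesis using Y Neg_Con fl_closedD[OF K, of "Con \<psi> \<chi>"] by auto
  next
    case (Box \<alpha> \<psi>)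
    then have \<alpha>: "Box \<alpha> \<psi> \<in> K" using \<phi> by auto
    obtain l where "Y = X l \<alpha> \<psi>" using Y Box by (auto simp: unfold_box_def)
    moreover have "boxes \<delta> \<psi> \<in> K" if "\<delta> \<in> P l \<alpha>" for \<delta>
      using P_imp_H[OF that] fl_closed_boxes[OF K \<alpha>] by blast
    ultimately have "Y \<subseteq> K \<union> Neg ` tests \<alpha>" by (auto simp: X_eq)
    then show ?thesis using fl_closed_tests[OF K \<alpha>] by blast
  next
    case (Neg_Box \<alpha> \<psi>)
    then have \<alpha>: "Box \<alpha> \<psi> \<in> K" using \<phi> Neg[of "Box \<alpha> \<psi>"] by simp
    obtain Z \<delta> where Z: "(Z, \<delta>) \<in> H \<alpha>" "Y = Z \<union> {Neg (boxes \<delta> \<psi>)}"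
      using Y Neg_Box by (auto simp: unfold_dia_def)
    then show ?thesis
      using fl_closed_tests[OF K \<alpha>] fl_closed_boxes[OF K \<alpha> Z(1)] H_tests[OF Z(1)] by auto
  qed (use \<phi> Y in auto)
qed

definition rule_closed :: "('p, 'a) fm set \<Rightarrow> bool" where
  "rule_closed C \<longleftrightarrow> (\<forall>\<phi>\<in>C. \<forall>Y\<in>expansions \<phi>. Y \<subseteq> C) \<and>
     (\<forall>a \<psi>. Box (Atom a) \<psi> \<in> C \<longrightarrow> \<psi> \<in> C) \<and> (\<forall>a \<psi>. Neg (Box (Atom a) \<psi>) \<in> C \<longrightarrow> Neg \<psi> \<in> C)"

lemma rule_closed_superset_exists:
  assumes "finite \<Phi>"
  obtains C where "finite C" "\<Phi> \<subseteq> C" "rule_closed C"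
proof
  let ?K = "\<Union>\<phi>\<in>\<Phi>. fl \<phi>"
  have K: "fl_closed ?K" by (rule fl_closed_UN_fl)
  show "finite (?K \<union> Neg ` ?K)" using assms by (simp add: finite_fl)
  show "\<Phi> \<subseteq> ?K \<union> Neg ` ?K" using fl_self by blast
  show "rule_closed (?K \<union> Neg ` ?K)"
    unfolding rule_closed_def
  proof (intro conjI allI impI ballI)
    show "Y \<subseteq> ?K \<union> Neg ` ?K" if "\<phi> \<in> ?K \<union> Neg ` ?K" "Y \<in> expansions \<phi>" for \<phi> Y
      by (rule fl_closed_expansions[OF K that])
    show "\<psi> \<in> ?K \<union> Neg ` ?K" if "Box (Atom a) \<psi> \<in> ?K \<union> Neg ` ?K" for a \<psi>
      using that fl_closed_tail[OF K] by blast
    show "Neg \<psi> \<in> ?K \<union> Neg ` ?K" if "Neg (Box (Atom a) \<psi>) \<in> ?K \<union> Neg ` ?K" for a \<psi>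
    proof -
      have "Box (Atom a) \<psi> \<in> ?K" using that fl_closedD[OF K, of "Neg (Box (Atom a) \<psi>)"] by auto
      then have "\<psi> \<in> ?K" by (rule fl_closed_tail[OF K])
      then show ?thesis by simp
    qed
  qed
qed

lemma rule_inst_closed:
  assumes "rule_inst r \<Gamma> G" "rule_closed C" "unload ` \<Gamma> \<subseteq> C" "\<Gamma>' \<in> G"
  shows "unload ` \<Gamma>' \<subseteq> C"
  using assms(1)
proof (cases rule: rule_inst_cases)
  case (expansion \<Delta> f)
  then obtain \<Gamma>'' where \<Gamma>'': "\<Gamma>' = \<Delta> \<union> \<Gamma>''" "\<Gamma>'' \<in> sfm_expansions f" using assms(4) by blast
  have "unload f \<in> C" using expansion assms(3) by simp
  then have "unload ` \<Gamma>'' \<subseteq> C"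
    using sfm_expansions_unload[OF \<Gamma>''(2)] assms(2) unfolding rule_closed_def by blast
  then show ?thesis using \<Gamma>''(1) expansion(1) assms(3) by auto
next
  case (modal \<Delta> a \<xi>)
  then have "Neg (Box (Atom a) (unload_box \<xi>)) \<in> C" using assms(3) by simp
  then have "Neg (unload_box \<xi>) \<in> C" using assms(2) unfolding rule_closed_def by blast
  moreover have "\<phi> \<in> C" if "Free (Box (Atom a) \<phi>) \<in> \<Delta>" for \<phi>
  proof -
    have "Box (Atom a) \<phi> \<in> C" using that modal assms(3) by force
    then show ?thesis using assms(2) unfolding rule_closed_def by blast
  qed
  ultimately show ?thesis using modal assms(4) by (auto simp: proj_def)
qed (use assms(3,4) in auto)

section \<open>Refuting paths\<close>

definition refutes :: "'w set \<Rightarrow> ('a \<Rightarrow> ('w \<times> 'w) set) \<Rightarrow> (('p, 'a) fm \<Rightarrow> 'w \<Rightarrow> bool)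
    \<Rightarrow> ('p, 'a) lbox \<Rightarrow> 'w \<Rightarrow> 'w \<Rightarrow> bool" where
  "refutes S R T \<xi> w v \<longleftrightarrow> (w, v) \<in> progs_rel S R T (lbox_progs \<xi>) \<and> T (Neg (lbox_core \<xi>)) v"

lemma refutes_Plain [simp]: "refutes S R T (Plain \<phi>) w v \<longleftrightarrow> w = v \<and> T (Neg \<phi>) v"
  by (auto simp: refutes_def)

lemma refutes_LBox:
  "refutes S R T (LBox \<alpha> \<xi>) w v \<longleftrightarrow> (\<exists>u. (w, u) \<in> prog_rel S R T \<alpha> \<and> refutes S R T \<xi> u v)"
  by (auto simp: refutes_def)

lemma refutes_lboxes:
  "refutes S R T (lboxes \<delta> \<xi>) w v \<longleftrightarrow> (\<exists>u. (w, u) \<in> progs_rel S R T \<delta> \<and> refutes S R T \<xi> u v)"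
  by (auto simp: refutes_def progs_rel_append)

lemma refutes_LBox_iff_expansion:
  assumes "\<forall>a. R a \<subseteq> S \<times> S" "w \<in> S"
  shows "refutes S R T (LBox \<alpha> \<xi>) w v \<longleftrightarrow>
    (\<exists>(Y, \<delta>)\<in>H \<alpha>. (\<forall>\<tau>\<in>Y. T \<tau> w) \<and> refutes S R T (lboxes \<delta> \<xi>) w v)"
proof -
  have "prog_rel S R T \<alpha> `` {w} = unfolded_rel S R T \<alpha> `` {w}"
    using prog_rel_imp_unfolded_rel[OF _ assms(1)] unfolded_rel_imp_prog_rel[OF _ assms(2)] by blast
  then have eq: "(w, u) \<in> prog_rel S R T \<alpha> \<longleftrightarrow> (w, u) \<in> unfolded_rel S R T \<alpha>" for u by blast
  show ?thesis unfolding refutes_LBox refutes_lboxes eq by (auto simp: unfolded_rel_def; blast)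
qed

lemma refutes_mono:
  assumes "\<And>\<alpha> \<tau> w. \<alpha> \<in> set (lbox_progs \<xi>) \<Longrightarrow> \<tau> \<in> tests \<alpha> \<Longrightarrow> w \<in> S \<Longrightarrow> T \<tau> w \<Longrightarrow> T' \<tau> w"
    and "T (Neg (lbox_core \<xi>)) v \<Longrightarrow> T' (Neg (lbox_core \<xi>)) v"
  shows "refutes S R T \<xi> w v \<Longrightarrow> refutes S R T' \<xi> w v"
  using progs_rel_mono[of "lbox_progs \<xi>" S T T' R] assms unfolding refutes_def by blast

abbreviation falsifies :: "('w, 'p, 'a) kripke \<Rightarrow> ('p, 'a) lbox \<Rightarrow> 'w \<Rightarrow> 'w \<Rightarrow> bool" where
  "falsifies M \<equiv> refutes (states M) (acc M) (sat M)"

lemma sat_unload_box_iff: "sat M (unload_box \<xi>) w \<longleftrightarrow> (\<nexists>v. falsifies M \<xi> w v)"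
  unfolding unload_box_eq_boxes sat_boxes refutes_def by simp

section \<open>Soundness\<close>

definition sats :: "('w, 'p, 'a) kripke \<Rightarrow> ('p, 'a) sequent \<Rightarrow> 'w \<Rightarrow> bool" where
  "sats M \<Gamma> w \<longleftrightarrow> (\<forall>f\<in>\<Gamma>. sat M (unload f) w)"

lemma sats_simps [simp]:
  "sats M (\<Delta> \<union> \<Gamma>) w \<longleftrightarrow> sats M \<Delta> w \<and> sats M \<Gamma> w"
  "sats M (insert f \<Gamma>) w \<longleftrightarrow> sat M (unload f) w \<and> sats M \<Gamma> w"
  "sats M (Free ` Y) w \<longleftrightarrow> (\<forall>\<phi>\<in>Y. sat M \<phi> w)"
  by (auto simp: sats_def)

lemma closed_sequent_unsat:
  assumes "closed_sequent \<Gamma>"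
  shows "\<not> sats M \<Gamma> w"
proof
  assume "sats M \<Gamma> w"
  then have "sat M \<phi> w" if "Free \<phi> \<in> \<Gamma>" for \<phi> using that unfolding sats_def by force
  then show False using assms unfolding closed_sequent_def by (metis sat.simps(1,3))
qed

lemma sats_sfm_expansion:
  assumes "kripke_model M" "w \<in> states M" "sat M (unload f) w"
  shows "\<exists>\<Gamma>\<in>sfm_expansions f. sats M \<Gamma> w"
proof -
  obtain Y where "Y \<in> expansions (unload f)" "\<forall>\<chi>\<in>Y. sat M \<chi> w"
    using sat_imp_sat_expansion[OF assms] by blast
  then show ?thesis unfolding unload_sfm_expansions[symmetric] by (auto simp: sats_def)
qed

lemma rule_inst_sound_free:
  assumes "rule_inst r \<Gamma> G" "\<not> loaded \<Gamma>" and M: "kripke_model M" "w \<in> states M" and "sats M \<Gamma> w"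
  shows "\<exists>\<Gamma>'\<in>G. sats M \<Gamma>' w"
  using assms(1)
proof (cases rule: rule_inst_cases)
  case (expansion \<Delta> f)
  then show ?thesis using sats_sfm_expansion[OF M, of f] assms(5) by auto
qed (use assms(2,5) in auto)

definition one_loaded :: "('p, 'a) sequent \<Rightarrow> bool" where
  "one_loaded \<Gamma> \<longleftrightarrow> (\<forall>\<alpha> \<xi> \<beta> \<zeta>. Loaded \<alpha> \<xi> \<in> \<Gamma> \<and> Loaded \<beta> \<zeta> \<in> \<Gamma> \<longrightarrow> \<alpha> = \<beta> \<and> \<xi> = \<zeta>)"

lemma one_loaded_if_not_loaded: "\<not> loaded \<Gamma> \<Longrightarrow> one_loaded \<Gamma>"
  by (auto simp: one_loaded_def loaded_def)

lemma one_loaded_insert: "\<not> loaded \<Delta> \<Longrightarrow> one_loaded (insert f \<Delta>)"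
  by (auto simp: one_loaded_def loaded_def)

lemma one_loaded_context: "one_loaded (insert (Loaded \<alpha> \<xi>) \<Delta>) \<Longrightarrow> Loaded \<alpha> \<xi> \<notin> \<Delta> \<Longrightarrow> \<not> loaded \<Delta>"
  by (auto simp: one_loaded_def loaded_def)

lemma rule_inst_one_loaded:
  assumes "rule_inst r \<Gamma> G" "one_loaded \<Gamma>" "\<Gamma>' \<in> G"
  shows "one_loaded \<Gamma>'"
  using assms(1)
proof (cases rule: rule_inst_cases)
  case (expansion \<Delta> f)
  show ?thesis
  proof (cases f)
    case (Free \<phi>)
    then show ?thesis using expansion assms(2,3) by (auto simp: one_loaded_def)
  next
    case (Loaded \<alpha> \<xi>)
    then have "\<not> loaded \<Delta>" using expansion assms(2) one_loaded_context by auto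
    moreover obtain Y \<delta> where "\<Gamma>' = insert (lneg (lboxes \<delta> \<xi>)) (\<Delta> \<union> Free ` Y)"
      using Loaded expansion assms(3) by (auto simp: unfold_ldia_def)
    ultimately show ?thesis by (simp add: one_loaded_insert)
  qed
qed (use assms(3) in \<open>auto simp: one_loaded_insert basic_imp_not_loaded\<close>)

definition loaded_falsifies :: "('w, 'p, 'a) kripke \<Rightarrow> ('p, 'a) sequent \<Rightarrow> 'w \<Rightarrow> 'w \<Rightarrow> bool" where
  "loaded_falsifies M \<Gamma> w v \<longleftrightarrow> (\<exists>\<alpha> \<xi>. Loaded \<alpha> \<xi> \<in> \<Gamma> \<and> falsifies M (LBox \<alpha> \<xi>) w v)"

lemma loaded_falsifies_exists:
  assumes "loaded \<Gamma>" "sats M \<Gamma> w"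
  shows "\<exists>v. loaded_falsifies M \<Gamma> w v"
proof -
  obtain \<alpha> \<xi> where "Loaded \<alpha> \<xi> \<in> \<Gamma>" using assms(1) by (auto simp: loaded_def)
  moreover then have "\<not> sat M (unload_box (LBox \<alpha> \<xi>)) w" using assms(2) by (auto simp: sats_def)
  ultimately show ?thesis unfolding sat_unload_box_iff loaded_falsifies_def by blast
qed

lemma loaded_falsifies_insert:
  assumes "\<not> loaded \<Delta>"
  shows "loaded_falsifies M (insert (Loaded \<alpha> \<xi>) \<Delta>) w v \<longleftrightarrow> falsifies M (LBox \<alpha> \<xi>) w v"
  using assms by (auto simp: loaded_falsifies_def loaded_def)

lemma sats_insert_lneg:
  assumes "sats M \<Delta> w" "\<not> loaded \<Delta>" "falsifies M \<xi> w v"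
  shows "sats M (insert (lneg \<xi>) \<Delta>) w"
    and "loaded (insert (lneg \<xi>) \<Delta>) \<Longrightarrow> loaded_falsifies M (insert (lneg \<xi>) \<Delta>) w v"
proof -
  have "\<not> sat M (unload_box \<xi>) w" using assms(3) by (auto simp: sat_unload_box_iff)
  then show "sats M (insert (lneg \<xi>) \<Delta>) w" using assms(1) by simp
  show "loaded_falsifies M (insert (lneg \<xi>) \<Delta>) w v" if "loaded (insert (lneg \<xi>) \<Delta>)"
    using that assms(2,3) by (cases \<xi>) (auto simp: loaded_falsifies_insert)
qed

lemma rule_inst_sound_loaded_expansion:
  assumes M: "kripke_model M" "w \<in> states M" and "sats M (\<Delta> \<union> {f}) w"
    and "loaded_falsifies M (\<Delta> \<union> {f}) w v" "one_loaded (\<Delta> \<union> {f})" "f \<notin> \<Delta>"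
  shows "\<exists>\<Gamma>\<in>sfm_expansions f. sats M (\<Delta> \<union> \<Gamma>) w \<and>
    (loaded (\<Delta> \<union> \<Gamma>) \<longrightarrow> loaded_falsifies M (\<Delta> \<union> \<Gamma>) w v)"
proof (cases f)
  case (Free \<phi>)
  then have "loaded_falsifies M (\<Delta> \<union> \<Gamma>) w v" for \<Gamma>
    using assms(4) unfolding loaded_falsifies_def by blast
  moreover obtain \<Gamma> where "\<Gamma> \<in> sfm_expansions f" "sats M \<Gamma> w"
    using sats_sfm_expansion[OF M, of f] assms(3) by auto
  ultimately show ?thesis using assms(3) by (intro bexI[of _ \<Gamma>]) simp_all
next
  case (Loaded \<alpha> \<xi>)
  then have free: "\<not> loaded \<Delta>" using one_loaded_context assms(5,6) by auto
  then have "falsifies M (LBox \<alpha> \<xi>) w v"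
    using assms(4) by (simp add: Loaded loaded_falsifies_insert)
  then obtain Y \<delta> where Y: "(Y, \<delta>) \<in> H \<alpha>" "\<forall>\<tau>\<in>Y. sat M \<tau> w" "falsifies M (lboxes \<delta> \<xi>) w v"
    unfolding refutes_LBox_iff_expansion[OF kripke_model_acc[OF M(1)] M(2)] by blast
  have "sats M (\<Delta> \<union> Free ` Y) w" "\<not> loaded (\<Delta> \<union> Free ` Y)" using assms(3) Y(2) free by auto
  from sats_insert_lneg[OF this Y(3)] show ?thesis using Y(1)
    by (intro bexI[of _ "Free ` Y \<union> {lneg (lboxes \<delta> \<xi>)}"]) (auto simp: Loaded unfold_ldia_def)
qed

lemma rule_inst_sound_modal:
  assumes M: "kripke_model M" and "sats M (insert (Loaded (Atom a) \<xi>) \<Delta>) w" "\<not> loaded \<Delta>"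
    and "loaded_falsifies M (insert (Loaded (Atom a) \<xi>) \<Delta>) w v"
  shows "\<exists>u. (w, u) \<in> acc M a \<and> falsifies M \<xi> u v \<and> sats M (insert (lneg \<xi>) (proj a \<Delta>)) u \<and>
    (loaded (insert (lneg \<xi>) (proj a \<Delta>)) \<longrightarrow> loaded_falsifies M (insert (lneg \<xi>) (proj a \<Delta>)) u v)"
proof -
  obtain u where u: "(w, u) \<in> acc M a" "falsifies M \<xi> u v"
    using assms(3,4) by (auto simp: loaded_falsifies_insert refutes_LBox)
  have "sats M (proj a \<Delta>) u" using assms(2) u(1) by (fastforce simp: proj_def sats_def)
  then show ?thesis using u sats_insert_lneg[of M "proj a \<Delta>" u \<xi> v] by auto
qed

lemma rule_inst_sound_loaded:
  fixes rank :: "'w \<Rightarrow> nat"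
  assumes r: "rule_inst r \<Gamma> G" and \<Gamma>: "loaded \<Gamma>" "one_loaded \<Gamma>" "finite \<Gamma>"
    and M: "kripke_model M" and rank: "\<forall>a. \<forall>(w, v)\<in>acc M a. rank w < rank v"
    and w: "w \<in> states M" "sats M \<Gamma> w" "loaded_falsifies M \<Gamma> w v"
  shows "\<exists>\<Gamma>'\<in>G. \<exists>w'\<in>states M. sats M \<Gamma>' w' \<and> (loaded \<Gamma>' \<longrightarrow>
    loaded_falsifies M \<Gamma>' w' v \<and> ((rank v - rank w', weights \<Gamma>'), (rank v - rank w, weights \<Gamma>))
      \<in> less_than <*lex*> mult less_than)"
  using r
proof (cases rule: rule_inst_cases)
  case (expansion \<Delta> f)
  obtain \<Gamma>' where "\<Gamma>' \<in> sfm_expansions f" "sats M (\<Delta> \<union> \<Gamma>') w"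
    "loaded (\<Delta> \<union> \<Gamma>') \<longrightarrow> loaded_falsifies M (\<Delta> \<union> \<Gamma>') w v"
    using rule_inst_sound_loaded_expansion[OF M w(1)] w(2,3) \<Gamma>(2) expansion by blast
  moreover then have "(weights (\<Delta> \<union> \<Gamma>'), weights \<Gamma>) \<in> mult less_than"
    using weights_expansion_less[of \<Delta> f \<Gamma>'] expansion \<Gamma>(3) by simp
  moreover have "\<Delta> \<union> \<Gamma>' \<in> G" using expansion calculation(1) by blast
  ultimately show ?thesis using w(1) by (intro bexI[of _ "\<Delta> \<union> \<Gamma>'"] bexI[of _ w]) simp_all
next
  case (lplus \<Delta> a \<delta> \<phi>)
  then show ?thesis using \<Gamma>(1) basic_imp_not_loaded by auto
next
  case (lminus \<Delta> \<delta> \<phi>)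
  then show ?thesis using w(1,2) basic_imp_not_loaded[of \<Delta>] by auto
next
  case (modal \<Delta> a \<xi>)
  let ?\<Gamma>' = "insert (lneg \<xi>) (proj a \<Delta>)"
  obtain u where u: "(w, u) \<in> acc M a" "falsifies M \<xi> u v" "sats M ?\<Gamma>' u"
    "loaded ?\<Gamma>' \<longrightarrow> loaded_falsifies M ?\<Gamma>' u v"
    using rule_inst_sound_modal[OF M, of a \<xi> \<Delta> w v] modal w basic_imp_not_loaded[of \<Delta>] by auto
  have "(u, v) \<in> (\<Union>a. acc M a)\<^sup>*" using u(2) progs_rel_subset_rtrancl[of "states M" "acc M" "sat M"]
    unfolding refutes_def by blast
  then have "rank u \<le> rank v"
    by (induction rule: rtrancl_induct) (use rank in \<open>fastforce intro: order_trans less_imp_le\<close>)+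
  then have "rank v - rank u < rank v - rank w" using rank u(1) by fastforce
  moreover have "u \<in> states M" using u(1) kripke_model_acc[OF M] by blast
  ultimately show ?thesis using u(3,4) modal(3) by auto
qed

subsection \<open>Branches of tableaux\<close>

lemma tableau_prefix:
  assumes "tableau_for \<Gamma> T" "t \<in> nodes T" "prefix s t"
  shows "s \<in> nodes T"
proof -
  have "s @ xs \<in> nodes T \<Longrightarrow> s \<in> nodes T" for xs
  proof (induction xs rule: rev_induct)
    case (snoc x xs)
    then have "s @ xs \<in> nodes T" using assms(1) unfolding tableau_for_def by (metis append.assoc)
    then show ?case by (rule snoc.IH)
  qed simp
  then show ?thesis using assms(2,3) by (auto simp: prefix_def)
qed

lemma strict_prefix_child:
  assumes "tableau_for \<Gamma> T" "t \<in> nodes T" "strict_prefix s t"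
  obtains u where "u \<in> children T s" "prefix u t"
proof -
  obtain x xs where t: "t = s @ x # xs" using assms(3) by (metis strict_prefixE')
  then have "prefix (s @ [x]) t" by simp
  then show ?thesis using that tableau_prefix[OF assms(1,2)] by (auto simp: children_def)
qed

lemma children_node: "t \<in> children T s \<Longrightarrow> t \<in> nodes T"
  by (auto simp: children_def)

lemma children_strict_prefix: "t \<in> children T s \<Longrightarrow> strict_prefix s t"
  by (auto simp: children_def strict_prefix_def)

lemma interior_or_leaf: "t \<in> nodes T \<Longrightarrow> interior T t \<or> leaf T t"
  by (auto simp: interior_def leaf_def)

lemma interior_rule_inst:
  "tableau_for \<Gamma> T \<Longrightarrow> interior T s \<Longrightarrow> rule_inst (applied T s) (lab T s) (lab T ` children T s)"
  by (simp add: tableau_for_def)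

lemma tableau_induct [consumes 2, case_names root child]:
  assumes "tableau_for \<Gamma> T" "t \<in> nodes T"
    and "Q []" "\<And>s t. s \<in> nodes T \<Longrightarrow> Q s \<Longrightarrow> t \<in> children T s \<Longrightarrow> interior T s \<Longrightarrow> Q t"
  shows "Q t"
  using assms(2)
proof (induction t rule: rev_induct)
  case (snoc i t)
  then have t: "t \<in> nodes T" "t @ [i] \<in> children T t"
    using assms(1) unfolding tableau_for_def children_def by blast+
  then show ?case using assms(4)[OF t(1) snoc.IH[OF t(1)] t(2)] by (auto simp: interior_def)
qed (rule assms(3))

lemma tableau_label_closed:
  assumes T: "tableau_for \<Gamma> T" and C: "rule_closed C" "unload ` \<Gamma> \<subseteq> C" and t: "t \<in> nodes T"
  shows "unload ` lab T t \<subseteq> C"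
  using T t
proof (induction rule: tableau_induct)
  case root
  then show ?case using T C(2) by (simp add: tableau_for_def)
next
  case (child s t)
  then show ?case using rule_inst_closed[OF interior_rule_inst[OF T] C(1)] by blast
qed

lemma tableau_one_loaded:
  assumes T: "tableau_for \<Gamma> T" and "\<not> loaded \<Gamma>" and t: "t \<in> nodes T"
  shows "one_loaded (lab T t)"
  using T t
proof (induction rule: tableau_induct)
  case root
  then show ?case using T assms(2) by (simp add: tableau_for_def one_loaded_if_not_loaded)
next
  case (child s t)
  then show ?case using rule_inst_one_loaded[OF interior_rule_inst[OF T]] by blast
qed

text \<open>It suffices to find some loaded path between equal labels: the companion is the last
  occurrence of the label on it.\<close>

lemma loaded_path_repeatI:
  assumes "s \<in> nodes T" "strict_prefix c s" "lab T c = lab T s"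
    and "\<And>d. prefix c d \<Longrightarrow> prefix d s \<Longrightarrow> loaded (lab T d)"
  shows "loaded_path_repeat T s"
proof -
  let ?Q = "\<lambda>c'. prefix c c' \<and> strict_prefix c' s \<and> lab T c' = lab T s"
  have "\<exists>c'. ?Q c' \<and> (\<forall>d. ?Q d \<longrightarrow> length d \<le> length c')"
    by (rule ex_has_greatest_nat[of ?Q c length "length s"])
      (use assms(2,3) in \<open>auto dest: prefix_length_less\<close>)
  then obtain c' where c': "?Q c'" "\<And>d. ?Q d \<Longrightarrow> length d \<le> length c'" by blast
  have "companion T s c'"
    unfolding companion_def
  proof (intro conjI allI impI)
    fix d assume d: "strict_prefix c' d \<and> strict_prefix d s"
    then have "prefix c d" using c'(1) by (meson prefix_order.order_trans prefix_order.less_imp_le)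
    then show "lab T d \<noteq> lab T s" using c'(2)[of d] d prefix_length_less[of c' d] by auto
  qed (use assms(1) c'(1) in auto)
  moreover have "loaded (lab T d)" if "prefix c' d" "prefix d s" for d
    using assms(4) that c'(1) prefix_order.order_trans by blast
  ultimately show ?thesis unfolding loaded_path_repeat_def by blast
qed

definition infinite_branch :: "('p, 'a) tableau \<Rightarrow> (nat \<Rightarrow> nat list) \<Rightarrow> bool" where
  "infinite_branch T b \<longleftrightarrow> (\<forall>i. b (Suc i) \<in> children T (b i))"

lemma infinite_branch_child: "infinite_branch T b \<Longrightarrow> b (Suc i) \<in> children T (b i)"
  by (simp add: infinite_branch_def)

lemma infinite_branch_length:
  assumes "infinite_branch T b"
  shows "length (b i) = length (b 0) + i"
proof (induction i)
  case (Suc i)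
  have "length (b (Suc i)) = Suc (length (b i))"
    using infinite_branch_child[OF assms, of i] by (auto simp: children_def)
  then show ?case using Suc by simp
qed simp

lemma infinite_branch_prefix:
  assumes "infinite_branch T b" "i \<le> j"
  shows "prefix (b i) (b j)"
  using assms(2)
proof (induction rule: dec_induct)
  case (step j)
  have "strict_prefix (b j) (b (Suc j))"
    using infinite_branch_child[OF assms(1)] by (rule children_strict_prefix)
  then show ?case using step.IH by (meson prefix_order.less_imp_le prefix_order.order_trans)
qed simp

lemma infinite_branch_strict_prefix:
  assumes "infinite_branch T b" "i < j"
  shows "strict_prefix (b i) (b j)"
  using infinite_branch_prefix[OF assms(1), of i j] infinite_branch_length[OF assms(1), of i]
    infinite_branch_length[OF assms(1), of j] assms(2) by (auto simp: strict_prefix_def)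

lemma infinite_branch_between:
  assumes b: "infinite_branch T b" and d: "prefix (b m) d" "prefix d (b n)"
  shows "\<exists>j\<ge>m. d = b j"
proof -
  have len: "length (b m) \<le> length d" "length d \<le> length (b n)" using d prefix_length_le by blast+
  define j where "j = length d - length (b 0)"
  have j: "m \<le> j" "j \<le> n" "length (b j) = length d"
    using len infinite_branch_length[OF b, of m] infinite_branch_length[OF b, of n]
      infinite_branch_length[OF b, of j] unfolding j_def by linarith+
  have "prefix d (b j)"
    using prefix_length_prefix[OF d(2) infinite_branch_prefix[OF b j(2)]] j(3) by simp
  then have "d = b j" using j(3) by (auto simp: prefix_def)
  then show ?thesis using j(1) by blast
qed

lemma infinite_nat_image_repeats:
  fixes f :: "nat \<Rightarrow> 'b"
  assumes "infinite N" "f ` N \<subseteq> B" "finite B"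
  obtains m n where "m \<in> N" "n \<in> N" "m < n" "f m = f n"
proof -
  have "\<not> inj_on f N" using assms finite_imageD finite_subset by metis
  then show ?thesis unfolding inj_on_def using that by (metis nat_neq_iff)
qed

lemma infinite_branch_repeat:
  assumes b: "infinite_branch T b" and node: "\<And>i. b i \<in> nodes T"
    and B: "finite B" "\<And>i. lab T (b i) \<in> B"
  shows "\<exists>n. loaded_path_repeat T (b n) \<or> free_repeat T (b n)"
proof (cases "infinite {i. \<not> loaded (lab T (b i))}")
  case True
  obtain m n where "\<not> loaded (lab T (b n))" "m < n" "lab T (b m) = lab T (b n)"
    by (rule infinite_nat_image_repeats[OF True, of "\<lambda>i. lab T (b i)" B]) (use B in auto)
  then have "free_repeat T (b n)"
    using node infinite_branch_strict_prefix[OF b] unfolding free_repeat_def repeat_def by blast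
  then show ?thesis by blast
next
  case False
  then obtain k where k: "\<And>i. k \<le> i \<Longrightarrow> loaded (lab T (b i))"
    by (metis (mono_tags, lifting) finite_nat_set_iff_bounded linorder_not_less mem_Collect_eq)
  obtain m n where mn: "k \<le> m" "m < n" "lab T (b m) = lab T (b n)"
    by (rule infinite_nat_image_repeats[of "{k..}" "\<lambda>i. lab T (b i)" B])
      (use B infinite_Ici in auto)
  have "loaded_path_repeat T (b n)"
  proof (rule loaded_path_repeatI[OF node infinite_branch_strict_prefix[OF b mn(2)] mn(3)])
    fix d assume "prefix (b m) d" "prefix d (b n)"
    then obtain j where "m \<le> j" "d = b j" using infinite_branch_between[OF b] by blast
    then show "loaded (lab T d)" using k mn(1) by simp
  qed
  then show ?thesis by blast
qed

definition child_rel :: "('p, 'a) tableau \<Rightarrow> (nat list \<times> nat list) set" where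
  "child_rel T = {(t, s). t \<in> children T s}"

lemma wf_child_rel:
  assumes T: "pdl_tableau_for \<Gamma> T" and B: "finite B" "\<And>t. t \<in> nodes T \<Longrightarrow> lab T t \<in> B"
  shows "wf (child_rel T)"
  unfolding wf_iff_no_infinite_down_chain
proof
  assume "\<exists>b. \<forall>i. (b (Suc i), b i) \<in> child_rel T"
  then obtain b where b: "infinite_branch T b" by (auto simp: infinite_branch_def child_rel_def)
  note child = infinite_branch_child[OF b]
  have node: "b i \<in> nodes T" for i
    using T children_node[OF child[of i]] children_strict_prefix[OF child[of i]] tableau_prefix
    unfolding pdl_tableau_for_def by (metis prefix_order.less_imp_le)
  obtain n where "loaded_path_repeat T (b n) \<or> free_repeat T (b n)"
    using infinite_branch_repeat[OF b node B(1) B(2)[OF node]] by blast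
  then have "leaf T (b n)" using T unfolding pdl_tableau_for_def by blast
  then show False using child[of n] by (simp add: leaf_def)
qed

lemma strict_prefix_trancl_child_rel:
  assumes T: "tableau_for \<Gamma> T" "t \<in> nodes T" and "strict_prefix s t"
  shows "(t, s) \<in> (child_rel T)\<^sup>+"
  using T assms(3)
proof (induction rule: tableau_induct)
  case (child u t)
  then have step: "(t, u) \<in> child_rel T" by (simp add: child_rel_def)
  obtain i where "t = u @ [i]" using child.hyps(2) by (auto simp: children_def)
  then have "s = u \<or> strict_prefix s u"
    using child.prems by (auto simp: strict_prefix_def prefix_snoc)
  then show ?case using step child.IH by (auto intro: trancl_into_trancl2)
qed simp

subsection \<open>Satisfiable nodes of closed tableaux\<close>

definition loaded_below :: "('p, 'a) tableau \<Rightarrow> nat list \<Rightarrow> nat list \<Rightarrow> bool" where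
  "loaded_below T s t \<longleftrightarrow> t \<in> nodes T \<and> strict_prefix s t \<and>
     (\<forall>d. strict_prefix s d \<and> prefix d t \<longrightarrow> loaded (lab T d))"

lemma loaded_below_child:
  assumes "t = s \<or> loaded_below T s t" "t' \<in> children T t" "loaded (lab T t')"
  shows "loaded_below T s t'"
  unfolding loaded_below_def
proof (intro conjI allI impI)
  obtain i where i: "t' = t @ [i]" using assms(2) by (auto simp: children_def)
  show "t' \<in> nodes T" using assms(2) by (rule children_node)
  show "strict_prefix s t'"
    using assms(1) children_strict_prefix[OF assms(2)] prefix_order.less_trans
    by (auto simp: loaded_below_def)
  fix d assume d: "strict_prefix s d \<and> prefix d t'"
  then have "d = t' \<or> prefix d t" by (simp add: i prefix_snoc)
  then show "loaded (lab T d)" using d assms(1,3) by (auto simp: loaded_below_def)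
qed

lemma loaded_below_companion:
  assumes T: "tableau_for \<Gamma> T" and "\<not> loaded (lab T s)" and t: "loaded_below T s t"
    and "loaded_path_repeat T t"
  obtains c where "loaded_below T s c" "lab T c = lab T t" "\<not> leaf T c"
proof -
  obtain c where c: "companion T t c" "\<And>d. prefix c d \<Longrightarrow> prefix d t \<Longrightarrow> loaded (lab T d)"
    using assms(4) unfolding loaded_path_repeat_def by blast
  have ct: "strict_prefix c t" "lab T c = lab T t" using c(1) by (auto simp: companion_def)
  have st: "t \<in> nodes T" "strict_prefix s t" using t by (auto simp: loaded_below_def)
  have "\<not> prefix c s" using c(2)[of s] assms(2) st(2) by (auto simp: strict_prefix_def)
  then have "strict_prefix s c"
    using ct(1) st(2) by (metis prefix_order.less_imp_le prefix_order.le_less prefix_same_cases)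
  moreover have "c \<in> nodes T"
    using tableau_prefix[OF T st(1)] ct(1) by (simp add: prefix_order.less_imp_le)
  moreover have "loaded (lab T d)" if "strict_prefix s d" "prefix d c" for d
    using t that ct(1) unfolding loaded_below_def
    by (meson prefix_order.less_imp_le prefix_order.order_trans)
  ultimately have "loaded_below T s c" by (simp add: loaded_below_def)
  moreover have "\<not> leaf T c"
    using strict_prefix_child[OF T st(1) ct(1)] by (auto simp: leaf_def)
  ultimately show ?thesis using that ct(2) by blast
qed

locale ranked_model_of_closed_tableau =
  fixes \<Gamma> :: "('p, 'a) sequent" and T :: "('p, 'a) tableau"
    and M :: "('w, 'p, 'a) kripke" and rank :: "'w \<Rightarrow> nat"
  assumes tableau: "tableau_for \<Gamma> T" and closed: "closed_tableau T" and free_root: "\<not> loaded \<Gamma>"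
    and model: "kripke_model M" and rank: "\<forall>a. \<forall>(w, v)\<in>acc M a. rank w < rank v"
begin

definition satisfied_free :: "nat list \<Rightarrow> bool" where
  "satisfied_free s \<longleftrightarrow> s \<in> nodes T \<and> \<not> loaded (lab T s) \<and> (\<exists>w\<in>states M. sats M (lab T s) w)"

lemma satisfied_leaf:
  assumes "leaf T t" "sats M (lab T t) w"
  shows "loaded_path_repeat T t"
  using assms closed closed_sequent_unsat[of "lab T t" M w] by (auto simp: closed_tableau_def)

lemma satisfied_loaded_interior:
  assumes "t \<in> nodes T" "\<not> leaf T t" "loaded (lab T t)"
    and w: "w \<in> states M" "sats M (lab T t) w" "loaded_falsifies M (lab T t) w v"
  obtains t' w' where "t' \<in> children T t" "w' \<in> states M" "sats M (lab T t') w'"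
    and "loaded (lab T t') \<Longrightarrow> loaded_falsifies M (lab T t') w' v"
    and "loaded (lab T t') \<Longrightarrow> ((rank v - rank w', weights (lab T t')),
      (rank v - rank w, weights (lab T t))) \<in> less_than <*lex*> mult less_than"
proof -
  have "rule_inst (applied T t) (lab T t) (lab T ` children T t)"
    using interior_or_leaf[OF assms(1)] interior_rule_inst[OF tableau] assms(2) by blast
  moreover have "one_loaded (lab T t)" "finite (lab T t)"
    using tableau_one_loaded[OF tableau free_root assms(1)] tableau assms(1)
    by (auto simp: tableau_for_def)
  ultimately show ?thesis
    using rule_inst_sound_loaded[OF _ assms(3) _ _ model rank w] that by blast
qed

text \<open>A loaded-path repeat passes the falsifying path on to its companion, which is no leaf: hence
  the last component of the measure.\<close>

lemma satisfied_free_below_loaded: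
  assumes free: "\<not> loaded (lab T s)" and "loaded_below T s t" "w \<in> states M" "sats M (lab T t) w"
    and "loaded_falsifies M (lab T t) w v"
  shows "\<exists>u. strict_prefix s u \<and> satisfied_free u"
proof -
  have "wf ((less_than <*lex*> mult less_than) <*lex*> less_than)"
    by (intro wf_lex_prod wf_less_than wf_mult)
  from this assms(2-) show ?thesis
  proof (induction "((rank v - rank w, weights (lab T t)), if leaf T t then 1 else 0 :: nat)"
      arbitrary: t w rule: wf_induct_rule)
    case less
    have t: "t \<in> nodes T" "strict_prefix s t" "loaded (lab T t)"
      using less.prems(1) by (auto simp: loaded_below_def)
    show ?case
    proof (cases "leaf T t")
      case True
      from satisfied_leaf[OF True less.prems(3)] obtain c where
        c: "loaded_below T s c" "lab T c = lab T t" "\<not> leaf T c"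
        using loaded_below_companion[OF tableau free less.prems(1)] by blast
      show ?thesis by (rule less.hyps[OF _ c(1)]) (use less.prems(2-) c(2,3) True in simp_all)
    next
      case False
      from satisfied_loaded_interior[OF t(1) False t(3) less.prems(2-4)] obtain t' w' where
        t': "t' \<in> children T t" and w': "w' \<in> states M" "sats M (lab T t') w'"
        and step: "loaded (lab T t') \<Longrightarrow> loaded_falsifies M (lab T t') w' v"
          "loaded (lab T t') \<Longrightarrow> ((rank v - rank w', weights (lab T t')),
            (rank v - rank w, weights (lab T t))) \<in> less_than <*lex*> mult less_than" by blast
      show ?thesis
      proof (cases "loaded (lab T t')")
        case True
        have "loaded_below T s t'" using loaded_below_child[OF _ t' True] less.prems(1) by blast
        then show ?thesis by (rule less.hyps[rotated]) (use w' step[OF True] in auto)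
      next
        case False
        then have "satisfied_free t'"
          using children_node[OF t'] w' by (auto simp: satisfied_free_def)
        moreover have "strict_prefix s t'"
          using t(2) children_strict_prefix[OF t'] by (rule prefix_order.less_trans)
        ultimately show ?thesis by blast
      qed
    qed
  qed
qed

lemma satisfied_free_descends:
  assumes "satisfied_free s"
  shows "\<exists>u. strict_prefix s u \<and> satisfied_free u"
proof -
  obtain w where w: "w \<in> states M" "sats M (lab T s) w"
    and s: "s \<in> nodes T" and free: "\<not> loaded (lab T s)"
    using assms by (auto simp: satisfied_free_def)
  have "\<not> loaded_path_repeat T s"
    using free by (auto simp: loaded_path_repeat_def companion_def strict_prefix_def)
  then have "\<not> leaf T s" using satisfied_leaf w(2) by blast
  then have "rule_inst (applied T s) (lab T s) (lab T ` children T s)"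
    using interior_or_leaf[OF s] interior_rule_inst[OF tableau] by blast
  from rule_inst_sound_free[OF this free model w] obtain t where
    t: "t \<in> children T s" "sats M (lab T t) w" by blast
  show ?thesis
  proof (cases "loaded (lab T t)")
    case True
    obtain v where "loaded_falsifies M (lab T t) w v"
      using loaded_falsifies_exists[OF True t(2)] by blast
    moreover have "loaded_below T s t" by (rule loaded_below_child[OF disjI1[OF refl] t(1) True])
    ultimately show ?thesis using satisfied_free_below_loaded[OF free _ w(1) t(2)] by blast
  next
    case False
    then have "satisfied_free t"
      using t(2) w(1) children_node[OF t(1)] by (auto simp: satisfied_free_def)
    then show ?thesis using children_strict_prefix[OF t(1)] by blast
  qed
qed

lemma root_unsatisfied:
  assumes "wf (child_rel T)" "w \<in> states M"
  shows "\<not> sats M \<Gamma> w"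
proof
  assume "sats M \<Gamma> w"
  then have root: "satisfied_free []"
    using tableau free_root assms(2) by (auto simp: satisfied_free_def tableau_for_def)
  have "\<not> satisfied_free s" for s
    using wf_trancl[OF assms(1)]
  proof (induction s rule: wf_induct_rule)
    case (less s)
    then show ?case using satisfied_free_descends strict_prefix_trancl_child_rel[OF tableau]
      unfolding satisfied_free_def by blast
  qed
  then show False using root by blast
qed

end

lemma closed_tableau_unsat_ranked:
  fixes M :: "('w, 'p, 'a) kripke" and rank :: "'w \<Rightarrow> nat"
  assumes T: "pdl_tableau_for (Free ` \<Phi>) T" "closed_tableau T" and "finite \<Phi>"
    and M: "kripke_model M" and rank: "\<forall>a. \<forall>(w, v)\<in>acc M a. rank w < rank v"
    and w: "w \<in> states M"
  shows "\<exists>\<phi>\<in>\<Phi>. \<not> sat M \<phi> w"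
proof -
  have tab: "tableau_for (Free ` \<Phi>) T" using T(1) by (simp add: pdl_tableau_for_def)
  interpret ranked_model_of_closed_tableau "Free ` \<Phi>" T M rank
    by unfold_locales (use tab T(2) M rank in auto)
  obtain C where C: "finite C" "\<Phi> \<subseteq> C" "rule_closed C"
    using rule_closed_superset_exists[OF assms(3)] .
  have "wf (child_rel T)"
  proof (rule wf_child_rel[OF T(1)])
    show "finite (Pow (unload -` C))" using finite_unload_vimage[OF C(1)] by simp
    show "lab T t \<in> Pow (unload -` C)" if "t \<in> nodes T" for t
      using tableau_label_closed[OF tab C(3) _ that] C(2) by auto
  qed
  from root_unsatisfied[OF this w] show ?thesis by simp
qed

subsection \<open>Bounded morphisms\<close>

definition bounded_morphism :: "('v, 'p, 'a) kripke \<Rightarrow> ('w, 'p, 'a) kripke \<Rightarrow> ('v \<Rightarrow> 'w) \<Rightarrow> bool" where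
  "bounded_morphism N M f \<longleftrightarrow> f ` states N \<subseteq> states M \<and>
     (\<forall>p. \<forall>w\<in>states N. w \<in> val N p \<longleftrightarrow> f w \<in> val M p) \<and>
     (\<forall>a. \<forall>w\<in>states N. f ` (acc N a `` {w}) = acc M a `` {f w})"

lemma bounded_morphism_rtrancl:
  assumes r: "\<And>w. w \<in> S \<Longrightarrow> f ` (r `` {w}) = r' `` {f w}" and "r \<subseteq> S \<times> S" and w: "w \<in> S"
  shows "f ` (r\<^sup>* `` {w}) = r'\<^sup>* `` {f w}"
proof (intro equalityI subsetI)
  fix x assume "x \<in> f ` (r\<^sup>* `` {w})"
  then obtain v where v: "(w, v) \<in> r\<^sup>*" "x = f v" by blast
  from v(1) have "(f w, f v) \<in> r'\<^sup>*"
  proof (induction rule: rtrancl_induct)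
    case (step u v)
    then have "(f u, f v) \<in> r'" using r[of u] assms(2) by blast
    then show ?case using step.IH by (rule rtrancl_into_rtrancl[rotated])
  qed simp
  then show "x \<in> r'\<^sup>* `` {f w}" using v(2) by blast
next
  fix x assume "x \<in> r'\<^sup>* `` {f w}"
  then have "(f w, x) \<in> r'\<^sup>*" by simp
  then show "x \<in> f ` (r\<^sup>* `` {w})"
  proof (induction rule: rtrancl_induct)
    case (step y z)
    then obtain u where u: "(w, u) \<in> r\<^sup>*" "y = f u" by blast
    then have "u \<in> S" using w assms(2) by (induction rule: rtrancl_induct) blast+
    then obtain v where "(u, v) \<in> r" "z = f v" using r[of u] step.hyps(2) u(2) by blast
    then show ?case using u(1) by (blast intro: rtrancl_into_rtrancl)
  qed blast
qed

lemma prel_subset_states: "kripke_model M \<Longrightarrow> prel M \<alpha> \<subseteq> states M \<times> states M"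
  unfolding prel_eq_prog_rel by (intro prog_rel_subset_Times kripke_model_acc)

lemma bounded_morphism_prel_Star:
  assumes N: "kripke_model N" and f: "bounded_morphism N M f"
    and \<alpha>: "\<And>w. w \<in> states N \<Longrightarrow> f ` (prel N \<alpha> `` {w}) = prel M \<alpha> `` {f w}" and w: "w \<in> states N"
  shows "f ` (prel N (Star \<alpha>) `` {w}) = prel M (Star \<alpha>) `` {f w}"
proof -
  have "(prel N \<alpha>)\<^sup>* `` states N = states N"
    using prel_subset_states[OF N, of \<alpha>] by (intro Image_closed_trancl) blast
  then have N_states: "(prel N \<alpha>)\<^sup>* `` {w} \<subseteq> states N" using w by blast
  have star: "f ` ((prel N \<alpha>)\<^sup>* `` {w}) = (prel M \<alpha>)\<^sup>* `` {f w}"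
    by (rule bounded_morphism_rtrancl[OF \<alpha> prel_subset_states[OF N] w])
  have f_states: "f ` states N \<subseteq> states M" using f by (simp add: bounded_morphism_def)
  then have "(prel M \<alpha>)\<^sup>* `` {f w} \<subseteq> states M" using N_states unfolding star[symmetric] by blast
  then have "prel M (Star \<alpha>) `` {f w} = (prel M \<alpha>)\<^sup>* `` {f w}" using f_states w by auto
  moreover have "prel N (Star \<alpha>) `` {w} = (prel N \<alpha>)\<^sup>* `` {w}" using N_states w by auto
  ultimately show ?thesis using star by simp
qed

lemma bounded_morphism_sat: "w \<in> states N \<Longrightarrow> sat N \<phi> w \<longleftrightarrow> sat M \<phi> (f w)"
  and bounded_morphism_prel: "w \<in> states N \<Longrightarrow> f ` (prel N \<alpha> `` {w}) = prel M \<alpha> `` {f w}"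
  if N: "kripke_model N" and f: "bounded_morphism N M f"
  for \<phi> :: "('p, 'a) fm" and N :: "('v, 'p, 'a) kripke" and M :: "('w, 'p, 'a) kripke"
proof (induction \<phi> and \<alpha> arbitrary: w and w rule: fm.induct prog.induct)
  case (Var p)
  then show ?case using f by (simp add: bounded_morphism_def)
next
  case (Box \<alpha> \<phi>)
  have "sat M (Box \<alpha> \<phi>) (f w) \<longleftrightarrow> (\<forall>v\<in>f ` (prel N \<alpha> `` {w}). sat M \<phi> v)"
    unfolding Box.IH(1)[OF Box.prems] by auto
  also have "\<dots> \<longleftrightarrow> sat N (Box \<alpha> \<phi>) w"
    using Box.IH(2) prel_subset_states[OF N, of \<alpha>] by auto
  finally show ?case by simp
next
  case (Atom a)
  then show ?case using f by (simp add: bounded_morphism_def)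
next
  case (Test \<tau>)
  then show ?case using f by (auto simp: bounded_morphism_def)
next
  case (Choice \<alpha> \<beta>)
  then show ?case by (simp add: image_Un Un_Image)
next
  case (Seq \<alpha> \<beta>)
  have "f ` (prel N (Seq \<alpha> \<beta>) `` {w}) = (\<Union>u\<in>prel N \<alpha> `` {w}. f ` (prel N \<beta> `` {u}))" by auto
  also have "\<dots> = (\<Union>u\<in>prel N \<alpha> `` {w}. prel M \<beta> `` {f u})"
    using Seq.IH(2) prel_subset_states[OF N, of \<alpha>] by (intro SUP_cong) auto
  also have "\<dots> = (\<Union>u\<in>f ` (prel N \<alpha> `` {w}). prel M \<beta> `` {u})" by simp
  also have "\<dots> = prel M (Seq \<alpha> \<beta>) `` {f w}" unfolding Seq.IH(1)[OF Seq.prems] by auto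
  finally show ?case .
next
  case (Star \<alpha>)
  show ?case by (rule bounded_morphism_prel_Star[OF N f Star.IH Star.prems])
qed auto

definition timed :: "('w, 'p, 'a) kripke \<Rightarrow> ('w \<times> nat, 'p, 'a) kripke" where
  "timed M = \<lparr>states = states M \<times> UNIV,
     acc = (\<lambda>a. {((w, n), (v, Suc n)) | w v n. (w, v) \<in> acc M a}),
     val = (\<lambda>p. val M p \<times> UNIV)\<rparr>"

lemma kripke_model_timed: "kripke_model M \<Longrightarrow> kripke_model (timed M)"
  by (fastforce simp: kripke_model_def timed_def)

lemma bounded_morphism_timed: "bounded_morphism (timed M) M fst"
  unfolding bounded_morphism_def by (force simp: timed_def image_iff)

lemma satisfiable_imp_consistent:
  assumes "finite \<Phi>" "satisfiable TYPE('w) \<Phi>"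
  shows "consistent \<Phi>"
  unfolding consistent_def
proof
  assume "\<exists>T. pdl_tableau_for (Free ` \<Phi>) T \<and> closed_tableau T"
  then obtain T where T: "pdl_tableau_for (Free ` \<Phi>) T" "closed_tableau T" by blast
  obtain M :: "('w, _, _) kripke" and w where M: "kripke_model M" "w \<in> states M" "\<forall>\<phi>\<in>\<Phi>. sat M \<phi> w"
    using assms(2) by (auto simp: satisfiable_def)
  note timed = kripke_model_timed[OF M(1)]
  have w: "(w, 0) \<in> states (timed M)" using M(2) by (simp add: timed_def)
  have "\<exists>\<phi>\<in>\<Phi>. \<not> sat (timed M) \<phi> (w, 0)"
    by (rule closed_tableau_unsat_ranked[where rank = snd, OF T assms(1) timed _ w])
      (auto simp: timed_def)
  then show False
    using bounded_morphism_sat[OF timed bounded_morphism_timed w] M(3) by simp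
qed

section \<open>The tableau game\<close>

text \<open>Coinductive because an infinite play through loaded sequents is won by the prover. The
  parameter \<open>W\<close> is the set of free sequents already known to be won.\<close>

coinductive_set loaded_win :: "('p, 'a) sequent set \<Rightarrow> ('p, 'a) sequent set"
  for W :: "('p, 'a) sequent set" where
  closed: "loaded \<Gamma> \<Longrightarrow> closed_sequent \<Gamma> \<Longrightarrow> \<Gamma> \<in> loaded_win W"
| rule: "loaded \<Gamma> \<Longrightarrow> rule_inst r \<Gamma> G \<Longrightarrow> \<forall>\<Gamma>'\<in>G. \<Gamma>' \<in> W \<or> \<Gamma>' \<in> loaded_win W \<Longrightarrow> \<Gamma> \<in> loaded_win W"

lemma loaded_win_mono:
  assumes "W \<subseteq> W'"
  shows "loaded_win W \<subseteq> loaded_win W'"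
proof
  fix \<Gamma> assume "\<Gamma> \<in> loaded_win W"
  then show "\<Gamma> \<in> loaded_win W'"
  proof (coinduction arbitrary: \<Gamma> rule: loaded_win.coinduct)
    case loaded_win
    then show ?case
    proof cases
      case (rule r G)
      then have "\<forall>\<Gamma>'\<in>G. \<Gamma>' \<in> W' \<or> \<Gamma>' \<in> loaded_win W \<or> \<Gamma>' \<in> loaded_win W'" using assms by blast
      with rule(1,2) show ?thesis by (intro disjI2 exI[of _ \<Gamma>] exI[of _ r] exI[of _ G]) auto
    qed simp
  qed
qed

lemma loaded_win_loaded: "\<Gamma> \<in> loaded_win W \<Longrightarrow> loaded \<Gamma>"
  by (erule loaded_win.cases) simp_all

definition free_win_step :: "('p, 'a) fm set \<Rightarrow> ('p, 'a) sequent set \<Rightarrow> ('p, 'a) sequent set" where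
  "free_win_step C W = {\<Gamma>. unload ` \<Gamma> \<subseteq> C \<and> \<not> loaded \<Gamma> \<and>
     (closed_sequent \<Gamma> \<or> (\<exists>r G. rule_inst r \<Gamma> G \<and> G \<subseteq> W \<union> loaded_win W))}"

lemma mono_free_win_step: "mono (free_win_step C)"
proof
  show "free_win_step C W \<subseteq> free_win_step C W'" if "W \<subseteq> W'" for W W'
    using that loaded_win_mono[OF that] unfolding free_win_step_def by blast
qed

definition free_win :: "('p, 'a) fm set \<Rightarrow> nat \<Rightarrow> ('p, 'a) sequent set" where
  "free_win C n = (free_win_step C ^^ n) {}"

lemma free_win_simps [simp]:
  "free_win C 0 = {}" "free_win C (Suc n) = free_win_step C (free_win C n)"
  by (simp_all add: free_win_def)

lemma free_win_not_loaded: "\<Gamma> \<in> free_win C n \<Longrightarrow> \<not> loaded \<Gamma>"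
  by (cases n) (auto simp: free_win_step_def)

lemma free_win_stabilises:
  assumes "finite C"
  obtains n where "free_win_step C (free_win C n) = free_win C n"
proof -
  have "free_win_step C W \<subseteq> Pow (unload -` C)" for W by (auto simp: free_win_step_def)
  moreover have "finite (Pow (unload -` C))" using finite_unload_vimage[OF assms] by simp
  ultimately obtain W where "while_option (\<lambda>W. free_win_step C W \<noteq> W) (free_win_step C) {} = Some W"
    using while_option_finite_subset_Some[OF mono_free_win_step, of "Pow (unload -` C)" C] by blast
  then obtain n where "W = (free_win_step C ^^ n) {}" "free_win_step C W = W"
    using while_option_stop2[of _ "free_win_step C" "{}" W] by blast
  then show ?thesis using that[of n] by (simp add: free_win_def)
qed

definition win :: "('p, 'a) fm set \<Rightarrow> nat \<Rightarrow> ('p, 'a) sequent set" where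
  "win C n = free_win C n \<union> loaded_win (free_win C n)"

definition win_rank :: "('p, 'a) fm set \<Rightarrow> ('p, 'a) sequent \<Rightarrow> nat" where
  "win_rank C \<Gamma> = (LEAST n. \<Gamma> \<in> win C n)"

lemma win_rank_le: "\<Gamma> \<in> win C n \<Longrightarrow> win_rank C \<Gamma> \<le> n"
  unfolding win_rank_def by (rule Least_le)

lemma win_move:
  assumes "\<Gamma> \<in> win C n" "\<not> closed_sequent \<Gamma>"
  shows "\<exists>r G. rule_inst r \<Gamma> G \<and> (\<exists>m\<le>n. G \<subseteq> win C m \<and> (loaded \<Gamma> \<or> m < n))"
proof (cases "loaded \<Gamma>")
  case True
  then have "\<Gamma> \<in> loaded_win (free_win C n)"
    using assms(1) free_win_not_loaded by (auto simp: win_def)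
  then obtain r G where "rule_inst r \<Gamma> G" "G \<subseteq> win C n"
    by cases (use assms(2) in \<open>auto simp: win_def\<close>)
  then show ?thesis using True by blast
next
  case False
  then have free: "\<Gamma> \<in> free_win C n" using assms(1) loaded_win_loaded by (auto simp: win_def)
  then obtain m where m: "n = Suc m" by (cases n) auto
  then obtain r G where "rule_inst r \<Gamma> G" "G \<subseteq> win C m"
    using free assms(2) by (auto simp: free_win_step_def win_def)
  then show ?thesis using m by (intro exI[of _ r] exI[of _ G] conjI exI[of _ m]) simp_all
qed

lemma win_rank_move:
  assumes "\<Gamma> \<in> win C n" "\<not> closed_sequent \<Gamma>"
  shows "\<exists>r G. rule_inst r \<Gamma> G \<and> (\<forall>\<Gamma>'\<in>G. (\<exists>m. \<Gamma>' \<in> win C m) \<and> win_rank C \<Gamma>' \<le> win_rank C \<Gamma> \<and>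
    (loaded \<Gamma> \<or> win_rank C \<Gamma>' < win_rank C \<Gamma>))"
proof -
  have "\<Gamma> \<in> win C (win_rank C \<Gamma>)" unfolding win_rank_def using assms(1) by (rule LeastI)
  from win_move[OF this assms(2)] obtain r G m where G: "rule_inst r \<Gamma> G" "G \<subseteq> win C m"
    and m: "m \<le> win_rank C \<Gamma>" "loaded \<Gamma> \<or> m < win_rank C \<Gamma>" by blast
  have "(\<exists>m. \<Gamma>' \<in> win C m) \<and> win_rank C \<Gamma>' \<le> win_rank C \<Gamma> \<and>
      (loaded \<Gamma> \<or> win_rank C \<Gamma>' < win_rank C \<Gamma>)" if "\<Gamma>' \<in> G" for \<Gamma>'
  proof -
    have "\<Gamma>' \<in> win C m" using G(2) that by blast
    then show ?thesis using win_rank_le[of \<Gamma>' C m] m by auto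
  qed
  then show ?thesis using G(1) by blast
qed

section \<open>From a winning strategy to a closed tableau\<close>

lemma lminus_after_lplus:
  assumes "rule_inst RLPlus \<Gamma> G" "\<Lambda> \<in> G" "rule_inst RLMinus \<Lambda> G'"
  shows "G' = {\<Gamma>}"
  using assms(1)
proof cases
  case (lplus a \<delta> \<phi> \<Delta>)
  let ?f = "Loaded (Atom a) (lboxes \<delta> (Plain \<phi>))"
  have \<Lambda>: "\<Lambda> = insert ?f \<Delta>" using lplus assms(2) by simp
  from assms(3) show ?thesis
  proof cases
    case (lminus \<eta> \<psi> \<Delta>')
    obtain \<alpha> \<xi> where principal: "lneg (lboxes \<eta> (Plain \<psi>)) = Loaded \<alpha> \<xi>" using lminus(3)
      by (cases \<eta>) auto
    then have eq: "Loaded \<alpha> \<xi> = ?f" using \<Lambda> lminus(1) lplus(4) by (auto simp: loaded_def)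
    then have "?f \<notin> \<Delta>'" using lminus(4) principal by simp
    moreover have "?f \<notin> \<Delta>" using lplus(4) by (auto simp: loaded_def)
    moreover have "insert ?f \<Delta>' = insert ?f \<Delta>" using lminus(1) \<Lambda> principal eq by simp
    ultimately have "\<Delta>' = \<Delta>" by (simp add: insert_ident)
    moreover have "Neg (boxes \<eta> \<psi>) = unload ?f" unfolding eq[symmetric] principal[symmetric] by simp
    ultimately show ?thesis using lminus(2) lplus(1) by simp
  qed
qed

locale winning_strategy =
  fixes root :: "('p, 'a) sequent" and won :: "('p, 'a) sequent set"
    and move :: "('p, 'a) sequent \<Rightarrow> rule_name"
    and options :: "('p, 'a) sequent \<Rightarrow> ('p, 'a) sequent list"
    and rank :: "('p, 'a) sequent \<Rightarrow> nat"
  assumes root_won: "root \<in> won" and finite_root: "finite root"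
    and legal: "\<Gamma> \<in> won \<Longrightarrow> \<not> closed_sequent \<Gamma> \<Longrightarrow> rule_inst (move \<Gamma>) \<Gamma> (set (options \<Gamma>))"
    and options_won: "\<Gamma> \<in> won \<Longrightarrow> \<not> closed_sequent \<Gamma> \<Longrightarrow> set (options \<Gamma>) \<subseteq> won"
    and rank_le: "\<Gamma> \<in> won \<Longrightarrow> \<not> closed_sequent \<Gamma> \<Longrightarrow> \<Gamma>' \<in> set (options \<Gamma>) \<Longrightarrow> rank \<Gamma>' \<le> rank \<Gamma>"
    and rank_less: "\<Gamma> \<in> won \<Longrightarrow> \<not> closed_sequent \<Gamma> \<Longrightarrow> \<Gamma>' \<in> set (options \<Gamma>) \<Longrightarrow> \<not> loaded \<Gamma> \<Longrightarrow>
      rank \<Gamma>' < rank \<Gamma>"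
begin

text \<open>The tree on all addresses serves to say where the play stops; a label at an address outside
  the tableau is meaningless.\<close>

definition label :: "nat list \<Rightarrow> ('p, 'a) sequent" where
  "label = foldl (\<lambda>\<Gamma> i. options \<Gamma> ! i) root"

definition full_tree :: "('p, 'a) tableau" where
  "full_tree = \<lparr>nodes = UNIV, lab = label, applied = move \<circ> label\<rparr>"

definition stopped :: "nat list \<Rightarrow> bool" where
  "stopped s \<longleftrightarrow> closed_sequent (label s) \<or> loaded_path_repeat full_tree s"

inductive_set play :: "nat list set" where
  start: "[] \<in> play"
| extend: "s \<in> play \<Longrightarrow> \<not> stopped s \<Longrightarrow> i < length (options (label s)) \<Longrightarrow> s @ [i] \<in> play"

definition strategy_tableau :: "('p, 'a) tableau" where
  "strategy_tableau = full_tree\<lparr>nodes := play\<rparr>"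

lemma strategy_tableau_simps [simp]:
  "nodes strategy_tableau = play" "lab strategy_tableau = label"
  "applied strategy_tableau = move \<circ> label"
  by (simp_all add: strategy_tableau_def full_tree_def)

lemma label_snoc: "label (s @ [i]) = options (label s) ! i"
  by (simp add: label_def)

lemma play_snoc_iff: "s @ [i] \<in> play \<longleftrightarrow> s \<in> play \<and> \<not> stopped s \<and> i < length (options (label s))"
  by (subst play.simps) auto

lemma label_won: "s \<in> play \<Longrightarrow> label s \<in> won"
proof (induction rule: play.induct)
  case start
  then show ?case using root_won by (simp add: label_def)
next
  case (extend s i)
  then have "options (label s) ! i \<in> set (options (label s))" by simp
  then show ?case using options_won[OF extend.IH] extend.hyps(2)
    by (auto simp: label_snoc stopped_def)
qed

lemma not_stopped_legal:
  "s \<in> play \<Longrightarrow> \<not> stopped s \<Longrightarrow> rule_inst (move (label s)) (label s) (set (options (label s)))"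
  using legal label_won by (simp add: stopped_def)

lemma finite_label: "s \<in> play \<Longrightarrow> finite (label s)"
proof (induction rule: play.induct)
  case start
  then show ?case using finite_root by (simp add: label_def)
next
  case (extend s i)
  then show ?case using rule_inst_finite(2)[OF not_stopped_legal] by (simp add: label_snoc)
qed

lemma children_strategy_tableau:
  "children strategy_tableau s =
    (if s \<in> play \<and> \<not> stopped s then (\<lambda>i. s @ [i]) ` {..<length (options (label s))} else {})"
  by (auto simp: children_def play_snoc_iff)

lemma label_children:
  assumes "s \<in> play" "\<not> stopped s"
  shows "label ` children strategy_tableau s = set (options (label s))"
proof -
  have "label ` children strategy_tableau s =
      (!) (options (label s)) ` {..<length (options (label s))}"
    using assms by (simp add: children_strategy_tableau image_image label_snoc)
  then show ?thesis by (auto simp: set_conv_nth)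
qed

lemma children_nonempty_iff: "children strategy_tableau s \<noteq> {} \<longleftrightarrow> s \<in> play \<and> \<not> stopped s"
  using rule_inst_nonempty[OF not_stopped_legal] label_children[of s]
  by (auto simp: children_strategy_tableau)

lemma leaf_strategy_tableau: "leaf strategy_tableau s \<longleftrightarrow> s \<in> play \<and> stopped s"
  using children_nonempty_iff by (auto simp: leaf_def)

lemma interior_strategy_tableau: "interior strategy_tableau s \<longleftrightarrow> s \<in> play \<and> \<not> stopped s"
  using children_nonempty_iff by (auto simp: interior_def)

lemma loaded_path_repeat_strategy_tableau:
  "loaded_path_repeat strategy_tableau s \<longleftrightarrow> s \<in> play \<and> loaded_path_repeat full_tree s"
  by (auto simp: loaded_path_repeat_def companion_def full_tree_def)

lemma rank_extension_le: "s @ xs \<in> play \<Longrightarrow> rank (label (s @ xs)) \<le> rank (label s)"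
proof (induction xs rule: rev_induct)
  case (snoc i xs)
  then have node: "s @ xs \<in> play" "\<not> stopped (s @ xs)" "i < length (options (label (s @ xs)))"
    using play_snoc_iff[of "s @ xs" i] by simp_all
  then have "rank (label ((s @ xs) @ [i])) \<le> rank (label (s @ xs))"
    unfolding label_snoc by (intro rank_le label_won) (simp_all add: stopped_def)
  then show ?case using snoc.IH[OF node(1)] by simp
qed simp

lemma free_label_not_repeated:
  assumes "t \<in> play" "strict_prefix s t" "\<not> loaded (label s)"
  shows "label t \<noteq> label s"
proof -
  obtain i xs where t: "t = (s @ [i]) @ xs"
    using assms(2) by (metis strict_prefixE' append.assoc append_Cons append_Nil)
  have prefix_play: "u @ ys \<in> play \<Longrightarrow> u \<in> play" for u ys
    by (induction ys rule: rev_induct) (simp_all add: play_snoc_iff flip: append_assoc)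
  then have "s @ [i] \<in> play" using assms(1) t by blast
  then have "rank (label (s @ [i])) < rank (label s)"
    unfolding label_snoc play_snoc_iff using assms(3)
    by (intro rank_less label_won) (simp_all add: stopped_def)
  then have "rank (label t) < rank (label s)"
    using rank_extension_le[of "s @ [i]" xs] assms(1) t by simp
  then show ?thesis by auto
qed

lemma lminus_not_after_lplus:
  assumes s: "interior strategy_tableau s" and t: "t \<in> children strategy_tableau s"
    "interior strategy_tableau t" and plus: "applied strategy_tableau s = RLPlus"
  shows "applied strategy_tableau t \<noteq> RLMinus"
proof
  assume minus: "applied strategy_tableau t = RLMinus"
  have sp: "s \<in> play" "\<not> stopped s" and tp: "t \<in> play" "\<not> stopped t"
    using s t(2) by (simp_all add: interior_strategy_tableau)
  have s_rule: "rule_inst RLPlus (label s) (set (options (label s)))"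
    using not_stopped_legal[OF sp] plus by simp
  moreover have "label t \<in> set (options (label s))" using t(1) label_children[OF sp] by blast
  moreover have "rule_inst RLMinus (label t) (set (options (label t)))"
    using not_stopped_legal[OF tp] minus by simp
  ultimately have "set (options (label t)) = {label s}" by (rule lminus_after_lplus)
  then obtain u where u: "u \<in> children strategy_tableau t" "label u = label s"
    using label_children[OF tp] by (metis imageE singletonI)
  have "\<not> loaded (label s)" using s_rule by cases auto
  moreover have "u \<in> play" using children_node[OF u(1)] by simp
  moreover have "strict_prefix s u"
    using children_strict_prefix[OF t(1)] children_strict_prefix[OF u(1)]
    by (rule prefix_order.less_trans)
  ultimately show False using free_label_not_repeated u(2) by blast
qed

lemma tableau_strategy_tableau: "tableau_for root strategy_tableau"
  unfolding tableau_for_def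
proof (intro conjI allI ballI impI)
  show "[] \<in> nodes strategy_tableau" by (simp add: play.start)
  show "lab strategy_tableau [] = root" by (simp add: label_def)
  fix s
  show "s \<in> nodes strategy_tableau" if "s @ [i] \<in> nodes strategy_tableau" for i
    using that by (simp add: play_snoc_iff)
  show "finite (children strategy_tableau s)" by (simp add: children_strategy_tableau)
  show "finite (lab strategy_tableau s)" if "s \<in> nodes strategy_tableau"
    using that by (simp add: finite_label)
  show "rule_inst (applied strategy_tableau s) (lab strategy_tableau s)
      (lab strategy_tableau ` children strategy_tableau s)" if "interior strategy_tableau s"
    using that not_stopped_legal label_children by (simp add: interior_strategy_tableau)
  show "applied strategy_tableau t \<noteq> RLMinus"
    if "interior strategy_tableau s \<and> t \<in> children strategy_tableau s \<and>
      interior strategy_tableau t \<and> applied strategy_tableau s = RLPlus" for t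
    using that lminus_not_after_lplus by blast
qed

lemma pdl_tableau_strategy_tableau: "pdl_tableau_for root strategy_tableau"
  unfolding pdl_tableau_for_def
proof (intro conjI allI impI tableau_strategy_tableau)
  fix s assume "loaded_path_repeat strategy_tableau s \<or> free_repeat strategy_tableau s"
  then show "leaf strategy_tableau s"
  proof
    assume "loaded_path_repeat strategy_tableau s"
    then show ?thesis
      by (simp add: loaded_path_repeat_strategy_tableau leaf_strategy_tableau stopped_def)
  next
    assume "free_repeat strategy_tableau s"
    then obtain c where "s \<in> play" "strict_prefix c s" "label s = label c" "\<not> loaded (label c)"
      by (auto simp: free_repeat_def repeat_def)
    then show ?thesis using free_label_not_repeated[of s c] by simp
  qed
qed

lemma closed_strategy_tableau: "closed_tableau strategy_tableau"
  by (auto simp: closed_tableau_def leaf_strategy_tableau stopped_def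
      loaded_path_repeat_strategy_tableau)

end

lemma closed_tableau_exists:
  assumes "\<Gamma> \<in> free_win C n" "finite \<Gamma>"
  shows "\<exists>T. pdl_tableau_for \<Gamma> T \<and> closed_tableau T"
proof -
  define won where "won = {\<Gamma>. finite \<Gamma> \<and> (\<exists>n. \<Gamma> \<in> win C n)}"
  define good_move where "good_move \<Gamma> r xs \<longleftrightarrow> rule_inst r \<Gamma> (set xs) \<and>
    (\<forall>\<Gamma>'\<in>set xs. \<Gamma>' \<in> won \<and> win_rank C \<Gamma>' \<le> win_rank C \<Gamma> \<and>
      (loaded \<Gamma> \<or> win_rank C \<Gamma>' < win_rank C \<Gamma>))" for \<Gamma> r xs
  have "\<exists>r xs. good_move \<Gamma> r xs" if \<Gamma>: "\<Gamma> \<in> won" "\<not> closed_sequent \<Gamma>" for \<Gamma>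
  proof -
    from \<Gamma>(1) obtain n where n: "\<Gamma> \<in> win C n" "finite \<Gamma>" by (auto simp: won_def)
    from win_rank_move[OF n(1) \<Gamma>(2)] obtain r G where G: "rule_inst r \<Gamma> G"
      "\<forall>\<Gamma>'\<in>G. (\<exists>m. \<Gamma>' \<in> win C m) \<and> win_rank C \<Gamma>' \<le> win_rank C \<Gamma> \<and>
        (loaded \<Gamma> \<or> win_rank C \<Gamma>' < win_rank C \<Gamma>)" by blast
    obtain xs where "set xs = G" using rule_inst_finite(1)[OF G(1) n(2)] finite_list by blast
    then have "good_move \<Gamma> r xs"
      using G rule_inst_finite(2)[OF G(1) n(2)] by (auto simp: won_def good_move_def)
    then show ?thesis by blast
  qed
  then obtain move options where
    strategy: "\<And>\<Gamma>. \<Gamma> \<in> won \<Longrightarrow> \<not> closed_sequent \<Gamma> \<Longrightarrow> good_move \<Gamma> (move \<Gamma>) (options \<Gamma>)" by metis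
  interpret winning_strategy \<Gamma> won move options "win_rank C"
  proof
    show "\<Gamma> \<in> won" "finite \<Gamma>" using assms by (auto simp: won_def win_def)
    fix \<Delta> assume "\<Delta> \<in> won" "\<not> closed_sequent \<Delta>"
    then have good: "good_move \<Delta> (move \<Delta>) (options \<Delta>)" by (rule strategy)
    then show "rule_inst (move \<Delta>) \<Delta> (set (options \<Delta>))" "set (options \<Delta>) \<subseteq> won"
      by (auto simp: good_move_def)
    fix \<Delta>' assume "\<Delta>' \<in> set (options \<Delta>)"
    with good show "win_rank C \<Delta>' \<le> win_rank C \<Delta>"
      and "\<not> loaded \<Delta> \<Longrightarrow> win_rank C \<Delta>' < win_rank C \<Delta>" by (auto simp: good_move_def)
  qed
  show ?thesis using pdl_tableau_strategy_tableau closed_strategy_tableau by blast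
qed

section \<open>Entailment by a basic sequent\<close>

inductive entails :: "('p, 'a) sequent \<Rightarrow> ('p, 'a) fm \<Rightarrow> bool" for \<Gamma> :: "('p, 'a) sequent" where
  basic: "basic_fm \<phi> \<Longrightarrow> Free \<phi> \<in> \<Gamma> \<Longrightarrow> entails \<Gamma> \<phi>"
| expand: "\<not> basic_fm \<phi> \<Longrightarrow> Y \<in> expansions \<phi> \<Longrightarrow> \<forall>\<chi>\<in>Y. entails \<Gamma> \<chi> \<Longrightarrow> entails \<Gamma> \<phi>"

lemma entails_basic_iff: "basic_fm \<phi> \<Longrightarrow> entails \<Gamma> \<phi> \<longleftrightarrow> Free \<phi> \<in> \<Gamma>"
  by (auto intro: entails.basic elim: entails.cases)

lemma entails_iff_expansion: "entails \<Gamma> \<phi> \<longleftrightarrow> (\<exists>Y\<in>expansions \<phi>. \<forall>\<chi>\<in>Y. entails \<Gamma> \<chi>)"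
proof (cases "basic_fm \<phi>")
  case True
  then show ?thesis by (simp add: expansions_basic)
next
  case False
  then show ?thesis by (subst entails.simps) blast
qed

lemma entails_Box_iff:
  "entails \<Gamma> (Box \<alpha> \<psi>) \<longleftrightarrow>
    (\<exists>l. (\<forall>\<tau>\<in>tests \<alpha> - l. entails \<Gamma> (Neg \<tau>)) \<and> (\<forall>\<delta>\<in>P l \<alpha>. entails \<Gamma> (boxes \<delta> \<psi>)))"
proof -
  have "entails \<Gamma> (Box \<alpha> \<psi>) \<longleftrightarrow> (\<exists>l. \<forall>\<chi>\<in>X l \<alpha> \<psi>. entails \<Gamma> \<chi>)"
    by (subst entails_iff_expansion) (simp add: unfold_box_eq_range)
  then show ?thesis by (simp add: X_eq ball_Un)
qed

lemma entails_Neg_BoxD: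
  "entails \<Gamma> (Neg (Box \<alpha> \<psi>)) \<Longrightarrow>
    \<exists>(Y, \<delta>)\<in>H \<alpha>. (\<forall>\<tau>\<in>Y. entails \<Gamma> \<tau>) \<and> entails \<Gamma> (Neg (boxes \<delta> \<psi>))"
  by (subst (asm) entails_iff_expansion) (auto simp: unfold_dia_eq_image)

lemma entails_Box_TestD: "entails \<Gamma> (Box (Test \<tau>) \<psi>) \<Longrightarrow> entails \<Gamma> (Neg \<tau>) \<or> entails \<Gamma> \<psi>"
  unfolding entails_Box_iff[of _ "Test \<tau>"] by (auto split: if_splits)

lemma entails_Box_ChoiceD:
  "entails \<Gamma> (Box (Choice \<alpha> \<beta>) \<psi>) \<Longrightarrow> entails \<Gamma> (Box \<alpha> \<psi>) \<and> entails \<Gamma> (Box \<beta> \<psi>)"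
  unfolding entails_Box_iff by auto

lemma entails_Box_SeqD:
  assumes "entails \<Gamma> (Box (Seq \<alpha> \<beta>) \<psi>)"
  shows "entails \<Gamma> (Box \<alpha> (Box \<beta> \<psi>))"
proof -
  obtain l where tests: "\<forall>\<tau>\<in>tests (Seq \<alpha> \<beta>) - l. entails \<Gamma> (Neg \<tau>)"
    and paths: "\<forall>\<delta>\<in>P l (Seq \<alpha> \<beta>). entails \<Gamma> (boxes \<delta> \<psi>)"
    using assms unfolding entails_Box_iff[of _ "Seq \<alpha> \<beta>"] by blast
  have "entails \<Gamma> (boxes \<delta> (Box \<beta> \<psi>))" if \<delta>: "\<delta> \<in> P l \<alpha>" for \<delta>
  proof (cases "\<delta> = []")
    case True
    then have "P l \<beta> \<subseteq> P l (Seq \<alpha> \<beta>)" using \<delta> by auto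
    then have "\<forall>\<delta>\<in>P l \<beta>. entails \<Gamma> (boxes \<delta> \<psi>)" using paths by blast
    moreover have "\<forall>\<tau>\<in>tests \<beta> - l. entails \<Gamma> (Neg \<tau>)" using tests by simp
    ultimately have "entails \<Gamma> (Box \<beta> \<psi>)" unfolding entails_Box_iff by blast
    then show ?thesis using True by simp
  next
    case False
    then have "\<delta> @ [\<beta>] \<in> P l (Seq \<alpha> \<beta>)" using \<delta> by auto
    from bspec[OF paths this] show ?thesis by simp
  qed
  moreover have "\<forall>\<tau>\<in>tests \<alpha> - l. entails \<Gamma> (Neg \<tau>)" using tests by simp
  ultimately show ?thesis unfolding entails_Box_iff[of _ \<alpha>] by blast
qed

lemma entails_Box_StarD:
  assumes "entails \<Gamma> (Box (Star \<alpha>) \<psi>)"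
  shows "entails \<Gamma> \<psi>" and "entails \<Gamma> (Box \<alpha> (Box (Star \<alpha>) \<psi>))"
proof -
  obtain l where tests: "\<forall>\<tau>\<in>tests \<alpha> - l. entails \<Gamma> (Neg \<tau>)"
    and paths: "\<forall>\<delta>\<in>P l (Star \<alpha>). entails \<Gamma> (boxes \<delta> \<psi>)"
    using assms unfolding entails_Box_iff[of _ "Star \<alpha>"] by auto
  show "entails \<Gamma> \<psi>" using paths by simp
  have "entails \<Gamma> (boxes \<delta> (Box (Star \<alpha>) \<psi>))" if \<delta>: "\<delta> \<in> P l \<alpha>" for \<delta>
  proof (cases "\<delta> = []")
    case True
    then show ?thesis using assms by simp
  next
    case False
    then have "\<delta> @ [Star \<alpha>] \<in> P l (Star \<alpha>)" using \<delta> by auto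
    from bspec[OF paths this] show ?thesis by simp
  qed
  then show "entails \<Gamma> (Box \<alpha> (Box (Star \<alpha>) \<psi>))"
    using tests unfolding entails_Box_iff[of _ \<alpha>] by blast
qed

section \<open>The canonical model\<close>

text \<open>\<open>W\<close> contains every free sequent won by the prover; \<open>label\<close> enumerates the states by points of
  the type from which they are to be drawn.\<close>

locale canonical_model =
  fixes C :: "('p, 'a) fm set" and W :: "('p, 'a) sequent set"
    and S :: "'w set" and label :: "'w \<Rightarrow> ('p, 'a) sequent"
  assumes finite_C: "finite C" and closed_C: "rule_closed C" and W_closed: "free_win_step C W \<subseteq> W"
    and label_image: "label ` S = {\<Gamma>. basic \<Gamma> \<and> unload ` \<Gamma> \<subseteq> C \<and> \<Gamma> \<notin> W}"
begin

abbreviation forced :: "('p, 'a) fm \<Rightarrow> 'w \<Rightarrow> bool" where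
  "forced \<phi> w \<equiv> entails (label w) \<phi>"

definition supports :: "'w \<Rightarrow> ('p, 'a) sequent \<Rightarrow> bool" where
  "supports w \<Delta> \<longleftrightarrow> (\<forall>\<phi>. Free \<phi> \<in> \<Delta> \<longrightarrow> forced \<phi> w)"

definition succ :: "'a \<Rightarrow> ('w \<times> 'w) set" where
  "succ a = {(w, v). w \<in> S \<and> v \<in> S \<and> supports v (proj a (label w))}"

definition model :: "('w, 'p, 'a) kripke" where
  "model = \<lparr>states = S, acc = succ, val = (\<lambda>p. {w \<in> S. Free (Var p) \<in> label w})\<rparr>"

lemma model_simps [simp]:
  "states model = S" "acc model = succ" "val model p = {w \<in> S. Free (Var p) \<in> label w}"
  by (simp_all add: model_def)

lemma succ_subset: "\<forall>a. succ a \<subseteq> S \<times> S"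
  by (auto simp: succ_def)

lemma label_state:
  assumes "w \<in> S"
  shows "basic (label w)" "unload ` label w \<subseteq> C" "label w \<notin> W"
proof -
  have "label w \<in> label ` S" using assms by blast
  then show "basic (label w)" "unload ` label w \<subseteq> C" "label w \<notin> W" unfolding label_image by auto
qed

lemma state_obtain:
  assumes "basic \<Gamma>" "unload ` \<Gamma> \<subseteq> C" "\<Gamma> \<notin> W"
  obtains w where "w \<in> S" "label w = \<Gamma>"
proof -
  have "\<Gamma> \<in> label ` S" unfolding label_image using assms by blast
  then show ?thesis using that by blast
qed

lemma not_won_open:
  assumes "\<not> loaded \<Gamma>" "unload ` \<Gamma> \<subseteq> C" "\<Gamma> \<notin> W"
  shows "\<not> closed_sequent \<Gamma>" and "rule_inst r \<Gamma> G \<Longrightarrow> \<exists>\<Gamma>'\<in>G. \<Gamma>' \<notin> W \<and> \<Gamma>' \<notin> loaded_win W"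
  using assms W_closed unfolding free_win_step_def by blast+

lemma finite_if_subset: "unload ` \<Gamma> \<subseteq> C \<Longrightarrow> finite \<Gamma>"
  using finite_unload_vimage[OF finite_C] by (meson finite_subset image_subset_iff_subset_vimage)

lemma supports_basic: "basic \<Delta> \<Longrightarrow> \<Delta> \<subseteq> label w \<Longrightarrow> supports w \<Delta>"
  unfolding supports_def using basic_iff entails_basic_iff by blast

lemma supports_expansion:
  assumes "Y \<in> expansions \<phi>" "supports w (\<Gamma> - {Free \<phi>} \<union> Free ` Y)"
  shows "supports w \<Gamma>"
proof -
  have "forced \<phi> w" using assms unfolding supports_def by (subst entails_iff_expansion) blast
  then show ?thesis using assms(2) by (auto simp: supports_def)
qed

lemma supporting_state_exists:
  assumes "\<not> loaded \<Gamma>" "unload ` \<Gamma> \<subseteq> C" "\<Gamma> \<notin> W"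
  shows "\<exists>w\<in>S. supports w \<Gamma>"
  using wf_mult[OF wf_less_than] assms
proof (induction "weights \<Gamma>" arbitrary: \<Gamma> rule: wf_induct_rule)
  case less
  show ?case
  proof (cases "basic \<Gamma>")
    case True
    then obtain w where "w \<in> S" "label w = \<Gamma>" using state_obtain less.prems(2,3) by blast
    then show ?thesis using supports_basic[OF True] by blast
  next
    case False
    then obtain \<phi> where \<phi>: "Free \<phi> \<in> \<Gamma>" "\<not> basic_fm \<phi>" using basic_iff less.prems(1) by blast
    let ?\<Delta> = "\<Gamma> - {Free \<phi>}"
    obtain r where r: "rule_inst r \<Gamma> {?\<Delta> \<union> Free ` Y | Y. Y \<in> expansions \<phi>}"
      using expansion_rule_inst_Free[OF \<phi>] .
    obtain Y where Y: "Y \<in> expansions \<phi>" "?\<Delta> \<union> Free ` Y \<notin> W"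
      using not_won_open(2)[OF less.prems r] by blast
    have "\<exists>w\<in>S. supports w (?\<Delta> \<union> Free ` Y)"
    proof (rule less.hyps[OF _ _ _ Y(2)])
      have "?\<Delta> \<union> {Free \<phi>} = \<Gamma>" using \<phi>(1) by blast
      then show "(weights (?\<Delta> \<union> Free ` Y), weights \<Gamma>) \<in> mult less_than"
        using weights_expansion_less[of ?\<Delta> "Free \<phi>" "Free ` Y"] finite_if_subset[OF less.prems(2)]
          \<phi>(2) Y(1) by simp
      show "\<not> loaded (?\<Delta> \<union> Free ` Y)" using less.prems(1) by (auto simp: loaded_def)
      show "unload ` (?\<Delta> \<union> Free ` Y) \<subseteq> C"
        by (rule rule_inst_closed[OF r closed_C less.prems(2)]) (use Y(1) in blast)
    qed
    then show ?thesis using supports_expansion[OF Y(1)] by blast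
  qed
qed

subsection \<open>Realising diamonds\<close>

abbreviation realises :: "('p, 'a) lbox \<Rightarrow> 'w \<Rightarrow> 'w \<Rightarrow> bool" where
  "realises \<equiv> refutes S succ forced"

definition fulfilled :: "('p, 'a) sequent \<Rightarrow> ('p, 'a) lbox \<Rightarrow> bool" where
  "fulfilled \<Delta> \<xi> \<longleftrightarrow> (\<exists>w\<in>S. supports w \<Delta> \<and> (\<exists>v. realises \<xi> w v))"

definition unfulfilled :: "('p, 'a) sequent \<Rightarrow> ('p, 'a) lbox \<Rightarrow> bool" where
  "unfulfilled \<Delta> \<xi> \<longleftrightarrow> \<not> loaded \<Delta> \<and> unload ` insert (lneg \<xi>) \<Delta> \<subseteq> C \<and> \<not> fulfilled \<Delta> \<xi>"

definition unfulfilled_sequents :: "('p, 'a) sequent set" where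
  "unfulfilled_sequents = {insert (Loaded \<alpha> \<xi>) \<Delta> | \<Delta> \<alpha> \<xi>. unfulfilled \<Delta> (LBox \<alpha> \<xi>)}"

lemma unfulfilled_won_or_loaded:
  assumes "unfulfilled \<Delta> \<xi>"
  shows "insert (lneg \<xi>) \<Delta> \<in> W \<union> unfulfilled_sequents"
proof (cases \<xi>)
  case (Plain \<phi>)
  have "insert (Free (Neg \<phi>)) \<Delta> \<in> W"
  proof (rule ccontr)
    assume "insert (Free (Neg \<phi>)) \<Delta> \<notin> W"
    then obtain w where "w \<in> S" "supports w (insert (Free (Neg \<phi>)) \<Delta>)"
      using supporting_state_exists[of "insert (Free (Neg \<phi>)) \<Delta>"] assms Plain
      by (auto simp: unfulfilled_def)
    then have "fulfilled \<Delta> \<xi>" using Plain by (auto simp: fulfilled_def supports_def)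
    then show False using assms by (simp add: unfulfilled_def)
  qed
  then show ?thesis using Plain by simp
next
  case (LBox \<alpha> \<zeta>)
  then show ?thesis using assms unfolding unfulfilled_sequents_def by auto
qed

lemma unfulfilled_move_context:
  assumes "unfulfilled \<Delta> (LBox \<alpha> \<xi>)" "\<not> basic \<Delta>"
  shows "\<exists>r G. rule_inst r (insert (Loaded \<alpha> \<xi>) \<Delta>) G \<and> G \<subseteq> W \<union> unfulfilled_sequents"
proof -
  let ?\<Lambda> = "insert (Loaded \<alpha> \<xi>) \<Delta>"
  have free: "\<not> loaded \<Delta>" and in_C: "unload ` ?\<Lambda> \<subseteq> C"
    and not_fulfilled: "\<not> fulfilled \<Delta> (LBox \<alpha> \<xi>)"
    using assms(1) by (simp_all add: unfulfilled_def)
  obtain \<phi> where \<phi>: "Free \<phi> \<in> \<Delta>" "\<not> basic_fm \<phi>" using assms(2) free basic_iff by blast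
  then have "Free \<phi> \<in> ?\<Lambda>" by simp
  from expansion_rule_inst_Free[OF this \<phi>(2)] obtain r where
    r: "rule_inst r ?\<Lambda> {?\<Lambda> - {Free \<phi>} \<union> Free ` Y | Y. Y \<in> expansions \<phi>}" .
  have "?\<Lambda> - {Free \<phi>} \<union> Free ` Y \<in> W \<union> unfulfilled_sequents" if Y: "Y \<in> expansions \<phi>" for Y
  proof -
    let ?\<Delta>' = "\<Delta> - {Free \<phi>} \<union> Free ` Y"
    have child: "?\<Lambda> - {Free \<phi>} \<union> Free ` Y = insert (lneg (LBox \<alpha> \<xi>)) ?\<Delta>'" by auto
    have "unload ` (?\<Lambda> - {Free \<phi>} \<union> Free ` Y) \<subseteq> C"
      by (rule rule_inst_closed[OF r closed_C in_C]) (use Y in blast)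
    moreover have "\<not> fulfilled ?\<Delta>' (LBox \<alpha> \<xi>)"
      using not_fulfilled supports_expansion[OF Y, of _ \<Delta>] unfolding fulfilled_def by blast
    moreover have "\<not> loaded ?\<Delta>'" using free by (auto simp: loaded_def)
    ultimately have "unfulfilled ?\<Delta>' (LBox \<alpha> \<xi>)" unfolding child by (simp add: unfulfilled_def)
    then show ?thesis unfolding child by (rule unfulfilled_won_or_loaded)
  qed
  then show ?thesis using r by blast
qed

lemma unfulfilled_move_program:
  assumes "unfulfilled \<Delta> (LBox \<alpha> \<xi>)" "\<not> atomic \<alpha>"
  shows "\<exists>r G. rule_inst r (insert (Loaded \<alpha> \<xi>) \<Delta>) G \<and> G \<subseteq> W \<union> unfulfilled_sequents"
proof -
  let ?\<Lambda> = "insert (Loaded \<alpha> \<xi>) \<Delta>" and ?G = "{\<Delta> \<union> \<Gamma> | \<Gamma>. \<Gamma> \<in> unfold_ldia \<alpha> \<xi>}"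
  have free: "\<not> loaded \<Delta>" and in_C: "unload ` ?\<Lambda> \<subseteq> C"
    and not_fulfilled: "\<not> fulfilled \<Delta> (LBox \<alpha> \<xi>)"
    using assms(1) by (simp_all add: unfulfilled_def)
  then have r: "rule_inst RLDia ?\<Lambda> ?G"
    using rule_inst.ldia[of \<alpha> \<xi> \<Delta>] assms(2) by (auto simp: loaded_def)
  have "\<Gamma> \<in> W \<union> unfulfilled_sequents" if \<Gamma>: "\<Gamma> \<in> ?G" for \<Gamma>
  proof -
    obtain Y \<delta> where Y: "(Y, \<delta>) \<in> H \<alpha>" and child: "\<Gamma> = insert (lneg (lboxes \<delta> \<xi>)) (\<Delta> \<union> Free ` Y)"
      using \<Gamma> by (auto simp: unfold_ldia_def)
    have "\<not> fulfilled (\<Delta> \<union> Free ` Y) (lboxes \<delta> \<xi>)"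
    proof
      assume "fulfilled (\<Delta> \<union> Free ` Y) (lboxes \<delta> \<xi>)"
      then obtain w v where w: "w \<in> S" "supports w (\<Delta> \<union> Free ` Y)" "realises (lboxes \<delta> \<xi>) w v"
        unfolding fulfilled_def by blast
      then have "\<forall>\<tau>\<in>Y. forced \<tau> w" by (auto simp: supports_def)
      then have "realises (LBox \<alpha> \<xi>) w v"
        using refutes_LBox_iff_expansion[OF succ_subset w(1)] Y w(3) by blast
      then show False using not_fulfilled w(1,2) by (auto simp: fulfilled_def supports_def)
    qed
    moreover have "unload ` \<Gamma> \<subseteq> C" by (rule rule_inst_closed[OF r closed_C in_C \<Gamma>])
    ultimately have "unfulfilled (\<Delta> \<union> Free ` Y) (lboxes \<delta> \<xi>)"
      using free unfolding child by (simp add: unfulfilled_def)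
    then show ?thesis unfolding child by (rule unfulfilled_won_or_loaded)
  qed
  then show ?thesis using r by blast
qed

lemma realises_LBox_Atom:
  assumes "w \<in> S" "proj a (label w) = proj a \<Delta>" "fulfilled (proj a \<Delta>) \<xi>"
  shows "\<exists>v. realises (LBox (Atom a) \<xi>) w v"
  using assms by (auto simp: fulfilled_def refutes_LBox succ_def)

text \<open>The prover unloads if that wins; otherwise the unloaded sequent is itself a state, and the
  modal step leads to an unfulfilled sequent.\<close>

lemma unfulfilled_move_modal:
  assumes "unfulfilled \<Delta> (LBox (Atom a) \<xi>)" "basic \<Delta>"
  shows "\<exists>r G. rule_inst r (insert (Loaded (Atom a) \<xi>) \<Delta>) G \<and> G \<subseteq> W \<union> unfulfilled_sequents"
proof -
  let ?\<Lambda> = "insert (Loaded (Atom a) \<xi>) \<Delta>"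
  define \<Gamma> where "\<Gamma> = insert (Free (Neg (Box (Atom a) (unload_box \<xi>)))) \<Delta>"
  have free: "\<not> loaded \<Delta>" and in_C: "unload ` ?\<Lambda> \<subseteq> C"
    and not_fulfilled: "\<not> fulfilled \<Delta> (LBox (Atom a) \<xi>)"
    using assms(1) by (simp_all add: unfulfilled_def)
  have notin: "Loaded (Atom a) \<xi> \<notin> \<Delta>" using free by (auto simp: loaded_def)
  have minus: "rule_inst RLMinus ?\<Lambda> {\<Gamma>}"
    using rule_inst.lminus[of "Atom a # lbox_progs \<xi>" "lbox_core \<xi>" \<Delta>] notin assms(2)
    by (simp add: \<Gamma>_def lboxes_progs_core unload_box_eq_boxes)
  have modal: "rule_inst RM ?\<Lambda> {insert (lneg \<xi>) (proj a \<Delta>)}"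
    using rule_inst.modal[OF notin assms(2)] by simp
  show ?thesis
  proof (cases "\<Gamma> \<in> W")
    case True
    then show ?thesis using minus by blast
  next
    case False
    have "basic \<Gamma>" using assms(2) by (auto simp: \<Gamma>_def basic_def)
    moreover have "unload ` \<Gamma> \<subseteq> C" by (rule rule_inst_closed[OF minus closed_C in_C]) simp
    ultimately obtain w where w: "w \<in> S" "label w = \<Gamma>" using state_obtain False by blast
    have "proj a (label w) = proj a \<Delta>" "supports w \<Delta>"
      using w(2) supports_basic[OF assms(2)] by (auto simp: \<Gamma>_def proj_def)
    then have "\<not> fulfilled (proj a \<Delta>) \<xi>"
      using not_fulfilled realises_LBox_Atom[OF w(1)] w(1) unfolding fulfilled_def[of \<Delta>] by blast
    moreover have "unload ` insert (lneg \<xi>) (proj a \<Delta>) \<subseteq> C"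
      by (rule rule_inst_closed[OF modal closed_C in_C]) simp
    ultimately have "unfulfilled (proj a \<Delta>) \<xi>" by (simp add: unfulfilled_def)
    then show ?thesis using modal unfulfilled_won_or_loaded by blast
  qed
qed

lemma unfulfilled_sequents_loaded_win: "unfulfilled_sequents \<subseteq> loaded_win W"
proof
  fix \<Lambda> assume "\<Lambda> \<in> unfulfilled_sequents"
  then show "\<Lambda> \<in> loaded_win W"
  proof (coinduction arbitrary: \<Lambda> rule: loaded_win.coinduct)
    case loaded_win
    then obtain \<Delta> \<alpha> \<xi> where \<Lambda>: "\<Lambda> = insert (Loaded \<alpha> \<xi>) \<Delta>" and \<Delta>: "unfulfilled \<Delta> (LBox \<alpha> \<xi>)"
      unfolding unfulfilled_sequents_def by blast
    obtain r G where r: "rule_inst r \<Lambda> G" "G \<subseteq> W \<union> unfulfilled_sequents"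
      using unfulfilled_move_context[OF \<Delta>] unfulfilled_move_program[OF \<Delta>]
        unfulfilled_move_modal[of \<Delta> _ \<xi>] \<Delta> unfolding \<Lambda> atomic_def by blast
    have "loaded \<Lambda>" unfolding \<Lambda> by simp
    with r show ?case by (intro disjI2 exI[of _ \<Lambda>] exI[of _ r] exI[of _ G]) auto
  qed
qed

lemma forced_Neg_Box_Atom_realised:
  assumes w: "w \<in> S" and dia: "forced (Neg (Box (Atom a) (unload_box \<xi>))) w"
    and core: "\<nexists>\<beta> \<psi>. lbox_core \<xi> = Box \<beta> \<psi>"
  shows "\<exists>v. realises (LBox (Atom a) \<xi>) w v"
proof -
  let ?f = "Free (Neg (Box (Atom a) (unload_box \<xi>)))"
  define \<Delta> where "\<Delta> = label w - {?f}"
  have "?f \<in> label w" using dia by (simp add: entails_basic_iff atomic_def)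
  then have label: "label w = insert ?f \<Delta>" "?f \<notin> \<Delta>" by (auto simp: \<Delta>_def)
  have basic: "basic \<Delta>" using label_state(1)[OF w] by (auto simp: \<Delta>_def basic_def)
  then have free: "\<not> loaded \<Delta>" by (rule basic_imp_not_loaded)
  let ?\<Lambda> = "insert (Loaded (Atom a) \<xi>) \<Delta>" and ?\<Gamma> = "insert (lneg \<xi>) (proj a \<Delta>)"
  have plus: "rule_inst RLPlus (label w) {?\<Lambda>}"
    using rule_inst.lplus[of a "lbox_progs \<xi>" "lbox_core \<xi>" \<Delta>] label free basic core
    by (simp add: lboxes_progs_core unload_box_eq_boxes)
  have modal: "rule_inst RM ?\<Lambda> {?\<Gamma>}"
    using rule_inst.modal[of a \<xi> \<Delta>] free basic by (auto simp: loaded_def)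
  have "?\<Lambda> \<notin> loaded_win W"
    using not_won_open(2)[OF _ label_state(2,3)[OF w] plus]
      basic_imp_not_loaded[OF label_state(1)[OF w]] by blast
  then have "?\<Gamma> \<notin> W" "?\<Gamma> \<notin> loaded_win W" using loaded_win.rule[OF _ modal, of W] by auto
  then have "\<not> unfulfilled (proj a \<Delta>) \<xi>"
    using unfulfilled_won_or_loaded unfulfilled_sequents_loaded_win by blast
  moreover have "unload ` ?\<Lambda> \<subseteq> C"
    by (rule rule_inst_closed[OF plus closed_C label_state(2)[OF w]]) simp
  then have "unload ` ?\<Gamma> \<subseteq> C" by (rule rule_inst_closed[OF modal closed_C]) simp
  ultimately have "fulfilled (proj a \<Delta>) \<xi>" by (simp add: unfulfilled_def)
  moreover have "proj a (label w) = proj a \<Delta>" unfolding label(1) by (auto simp: proj_def)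
  ultimately show ?thesis using realises_LBox_Atom[OF w] by blast
qed

lemma forced_Neg_unload_box_realised:
  assumes "w \<in> S" "forced (Neg (unload_box \<xi>)) w" and core: "\<nexists>\<beta> \<psi>. lbox_core \<xi> = Box \<beta> \<psi>"
  shows "\<exists>v. realises \<xi> w v"
  using assms
proof (induction \<xi>)
  case (LBox \<alpha> \<xi>)
  then obtain Y \<delta> where Y: "(Y, \<delta>) \<in> H \<alpha>" "\<forall>\<tau>\<in>Y. forced \<tau> w"
    "forced (Neg (boxes \<delta> (unload_box \<xi>))) w"
    using entails_Neg_BoxD[of "label w" \<alpha> "unload_box \<xi>"] by auto
  have "\<exists>v. realises (lboxes \<delta> \<xi>) w v"
  proof (cases "\<delta> = []")
    case True
    then show ?thesis using LBox.IH LBox.prems Y(3) by simp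
  next
    case False
    then obtain a \<eta> where "\<delta> = Atom a # \<eta>" using H_head[OF Y(1)] by blast
    then show ?thesis
      using forced_Neg_Box_Atom_realised[of w a "lboxes \<eta> \<xi>"] LBox.prems(1,3) Y(3) by simp
  qed
  then show ?case
    using refutes_LBox_iff_expansion[OF succ_subset LBox.prems(1)] Y(1,2) by blast
next
  case (Plain \<phi>)
  then have "realises (Plain \<phi>) w w" by simp
  then show ?case by blast
qed

subsection \<open>The truth lemma\<close>

lemma forced_Box_prog_rel:
  assumes "(w, v) \<in> prog_rel S succ (\<lambda>\<tau> w. \<not> forced (Neg \<tau>) w) \<alpha>" "forced (Box \<alpha> \<psi>) w"
  shows "forced \<psi> v"
  using assms
proof (induction \<alpha> arbitrary: w v \<psi> rule: prog_induct)
  case (Atom a)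
  then have "Free (Box (Atom a) \<psi>) \<in> label w" by (simp add: entails_basic_iff atomic_def)
  then show ?case using Atom(1) by (auto simp: succ_def supports_def proj_def)
next
  case (Test \<tau>)
  then show ?case using entails_Box_TestD[OF Test(2)] by simp
next
  case (Choice \<alpha> \<beta>)
  then have "forced (Box \<alpha> \<psi>) w" "forced (Box \<beta> \<psi>) w" using entails_Box_ChoiceD by blast+
  then show ?case using Choice.IH[of w v \<psi>] Choice.prems(1) by auto
next
  case (Seq \<alpha> \<beta>)
  from Seq.prems(1) obtain u where u: "(w, u) \<in> prog_rel S succ (\<lambda>\<tau> w. \<not> forced (Neg \<tau>) w) \<alpha>"
    "(u, v) \<in> prog_rel S succ (\<lambda>\<tau> w. \<not> forced (Neg \<tau>) w) \<beta>" by auto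
  show ?case by (rule Seq.IH(2)[OF u(2) Seq.IH(1)[OF u(1) entails_Box_SeqD[OF Seq.prems(2)]]])
next
  case (Star \<alpha>)
  have "(w, v) \<in> (prog_rel S succ (\<lambda>\<tau> w. \<not> forced (Neg \<tau>) w) \<alpha>)\<^sup>*" using Star.prems(1) by simp
  then have "forced (Box (Star \<alpha>) \<psi>) v"
  proof (induction rule: rtrancl_induct)
    case (step u v)
    show ?case by (rule Star.IH[OF step.hyps(2) entails_Box_StarD(2)[OF step.IH]])
  qed (rule Star.prems(2))
  then show ?case by (rule entails_Box_StarD(1))
qed

definition truthful :: "('p, 'a) fm \<Rightarrow> bool" where
  "truthful \<phi> \<longleftrightarrow>
     (\<forall>w\<in>S. (forced \<phi> w \<longrightarrow> sat model \<phi> w) \<and> (forced (Neg \<phi>) w \<longrightarrow> \<not> sat model \<phi> w))"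

lemma forced_Box_sat:
  assumes "\<And>\<tau>. \<tau> \<in> tests \<alpha> \<Longrightarrow> truthful \<tau>" "truthful \<psi>" and w: "w \<in> S" "forced (Box \<alpha> \<psi>) w"
  shows "sat model (Box \<alpha> \<psi>) w"
proof -
  have "prog_rel S succ (sat model) \<alpha> \<subseteq> prog_rel S succ (\<lambda>\<tau> w. \<not> forced (Neg \<tau>) w) \<alpha>"
    by (rule prog_rel_mono) (use assms(1) in \<open>auto simp: truthful_def\<close>)
  then have "forced \<psi> v \<and> v \<in> S" if "(w, v) \<in> prel model \<alpha>" for v
    using forced_Box_prog_rel[OF _ w(2)] that
      prog_rel_subset_Times[OF succ_subset, of "sat model" \<alpha>] unfolding prel_eq_prog_rel by auto
  then show ?thesis using assms(2) by (simp add: truthful_def)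
qed

lemma forced_Neg_unload_box_not_sat:
  assumes tests: "\<And>\<alpha> \<tau>. \<alpha> \<in> set (lbox_progs \<xi>) \<Longrightarrow> \<tau> \<in> tests \<alpha> \<Longrightarrow> truthful \<tau>"
    and core: "truthful (lbox_core \<xi>)" "\<nexists>\<beta> \<psi>. lbox_core \<xi> = Box \<beta> \<psi>"
    and w: "w \<in> S" "forced (Neg (unload_box \<xi>)) w"
  shows "\<not> sat model (unload_box \<xi>) w"
proof -
  obtain v where v: "realises \<xi> w v" using forced_Neg_unload_box_realised[OF w core(2)] by blast
  then have "v \<in> S" using progs_rel_closed[OF succ_subset _ w(1)] by (auto simp: refutes_def)
  then have "refutes S succ (sat model) \<xi> w v"
    by (intro refutes_mono[OF _ _ v]) (use tests core(1) in \<open>auto simp: truthful_def\<close>)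
  then show ?thesis unfolding sat_unload_box_iff by auto
qed

lemma truthful_Box:
  assumes smaller: "\<And>\<chi>. size \<chi> < size (Box \<alpha> \<psi>) \<Longrightarrow> truthful \<chi>"
  shows "truthful (Box \<alpha> \<psi>)"
proof -
  obtain \<xi> where \<xi>: "unload_box \<xi> = \<psi>" "\<nexists>\<beta> \<chi>. lbox_core \<xi> = Box \<beta> \<chi>"
    using maximal_unload_box by blast
  have \<psi>: "Box \<alpha> \<psi> = unload_box (LBox \<alpha> \<xi>)" by (simp add: \<xi>(1))
  have "\<not> sat model (unload_box (LBox \<alpha> \<xi>)) w"
    if w: "w \<in> S" "forced (Neg (unload_box (LBox \<alpha> \<xi>))) w" for w
  proof (rule forced_Neg_unload_box_not_sat[OF _ _ _ w])
    show "truthful \<tau>" if "\<beta> \<in> set (lbox_progs (LBox \<alpha> \<xi>))" "\<tau> \<in> tests \<beta>" for \<beta> \<tau>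
      using smaller size_tests[OF that(2)] size_lbox(2)[OF that(1)] unfolding \<psi> by simp
    show "truthful (lbox_core (LBox \<alpha> \<xi>))" using smaller size_lbox(1)[of \<xi>] by (simp add: \<psi>)
  qed (use \<xi>(2) in simp)
  moreover have "truthful \<tau>" if "\<tau> \<in> tests \<alpha>" for \<tau> using smaller size_tests[OF that] by simp
  ultimately show ?thesis using forced_Box_sat[of \<alpha> \<psi>] smaller[of \<psi>] \<psi> by (simp add: truthful_def)
qed

lemma truthful: "truthful \<phi>"
proof (induction \<phi> rule: measure_induct_rule[of size])
  case (less \<phi>)
  have consistent: "Free Bot \<notin> label w" "Free \<psi> \<in> label w \<Longrightarrow> Free (Neg \<psi>) \<notin> label w"
    if "w \<in> S" for w \<psi>
    using not_won_open(1)[OF basic_imp_not_loaded] label_state[OF that]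
    unfolding closed_sequent_def by blast+
  show ?case
  proof (cases \<phi>)
    case Bot
    then show ?thesis using consistent(1) by (simp add: truthful_def entails_basic_iff)
  next
    case (Var p)
    then show ?thesis using consistent(2) by (auto simp: truthful_def entails_basic_iff)
  next
    case (Neg \<psi>)
    then show ?thesis using less[of \<psi>] entails_iff_expansion[of _ "Neg (Neg \<psi>)"]
      by (auto simp: truthful_def)
  next
    case (Con \<psi> \<chi>)
    then show ?thesis using less[of \<psi>] less[of \<chi>] entails_iff_expansion[of _ "Con \<psi> \<chi>"]
        entails_iff_expansion[of _ "Neg (Con \<psi> \<chi>)"] by (auto simp: truthful_def)
  next
    case (Box \<alpha> \<psi>)
    then show ?thesis using truthful_Box less.IH by blast
  qed
qed

lemma satisfiable_if_not_won:
  assumes "Free ` \<Phi> \<notin> W" "\<Phi> \<subseteq> C"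
  shows "satisfiable TYPE('w) \<Phi>"
proof -
  obtain w where w: "w \<in> S" "supports w (Free ` \<Phi>)"
    using supporting_state_exists[of "Free ` \<Phi>"] assms by auto
  have "kripke_model model" using w(1) succ_subset by (auto simp: kripke_model_def)
  moreover have "\<forall>\<phi>\<in>\<Phi>. sat model \<phi> w" using w truthful by (simp add: supports_def truthful_def)
  ultimately show ?thesis using w(1) unfolding satisfiable_def by force
qed

end

lemma consistent_imp_satisfiable:
  fixes \<Phi> :: "('p, 'a) fm set"
  assumes "finite \<Phi>" "infinite (UNIV :: 'w set)" "consistent \<Phi>"
  shows "satisfiable TYPE('w) \<Phi>"
proof -
  obtain C where C: "finite C" "\<Phi> \<subseteq> C" "rule_closed C"
    using rule_closed_superset_exists[OF assms(1)] .
  obtain n where n: "free_win_step C (free_win C n) = free_win C n"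
    using free_win_stabilises[OF C(1)] .
  let ?states = "{\<Gamma>. basic \<Gamma> \<and> unload ` \<Gamma> \<subseteq> C \<and> \<Gamma> \<notin> free_win C n}"
  have "?states \<subseteq> Pow (unload -` C)" by auto
  then have finite_states: "finite ?states"
    using finite_unload_vimage[OF C(1)] finite_subset by blast
  obtain S :: "'w set" where S: "finite S" "card S = card ?states"
    using infinite_arbitrarily_large[OF assms(2), of "card ?states"] by blast
  obtain label where "bij_betw label S ?states"
    using finite_same_card_bij[OF S(1) finite_states S(2)] by blast
  then interpret canonical_model C "free_win C n" S label
    by unfold_locales (use C n in \<open>simp_all add: bij_betw_imp_surj_on\<close>)
  have "Free ` \<Phi> \<notin> free_win C n"
    using closed_tableau_exists[of "Free ` \<Phi>" C n] assms(1,3) unfolding consistent_def by blast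
  then show ?thesis by (rule satisfiable_if_not_won[OF _ C(2)])
qed

theorem theorem4p11:
  fixes \<Phi> :: "('p, 'a) fm set"
  assumes "finite \<Phi>"
    and "infinite (UNIV :: 'w set)"
  shows "consistent \<Phi> \<longleftrightarrow> satisfiable TYPE('w) \<Phi>"
  using consistent_imp_satisfiable[OF assms] satisfiable_imp_consistent[OF assms(1)] by blast

end
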